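(* Let $\mathcal{D}$ be a set, let $A$ be a Com-Prelie algebra, and let $a_d\in A$ for all $d\in\mathcal{D}$. There exists a unique morphism of Com-Prelie algebras $\phi:\mathfrak{g}_{\mathcal{PT}(\mathcal{D})}\to A$ such that $\phi(\cdot_d)=a_d$ for all $d\in\mathcal{D}$. In other words, $\mathfrak{g}_{\mathcal{PT}(\mathcal{D})}$ is the free Com-Prelie algebra generated by $\mathcal{D}$.
   Context: All vector spaces are over a field $\mathbb{K}$ of characteristic zero. A Com-Prelie algebra is a triple $(A,\bullet,\sqcup\!\sqcup)$ where $A$ is a vector space, $\bullet$ is a right prelie product ($(x\bullet y)\bullet z-x\bullet(y\bullet z)=(x\bullet z)\bullet y-x\bullet(z\bullet y)$), $\sqcup\!\sqcup$ is a commutative associative product (not necessarily unitary), and $(a\sqcup\!\sqcup b)\bullet c=(a\bullet c)\sqcup\!\sqcup b+a\sqcup\!\sqcup(b\bullet c)$ for all $a,b,c$. Morphisms are linear maps respecting both products. A partitioned forest is a pair $(F,I)$ where $F$ is a rooted forest (edges oriented from the leaves to the roots) and $I$ is a partition of the set of vertices of $F$ such that if two vertices are in the same part of $I$, then either they are both roots, or they have the same direct descendant (i.e. are attached to the same vertex immediately below them). A partitioned tree is a (nonempty) partitioned forest all of whose roots are in the same part. A partitioned tree decorated by $\mathcal{D}$ is a partitioned tree with a map from its vertices to $\mathcal{D}$. $\mathcal{PT}(\mathcal{D})$ is the set of isoclasses of partitioned trees decorated by $\mathcal{D}$, and $\mathfrak{g}_{\mathcal{PT}(\mathcal{D})}$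 is the vector space with basis $\mathcal{PT}(\mathcal{D})$. $\cdot_d$ is the tree with one vertex, decorated by $d$. For $t,t'\in\mathcal{PT}(\mathcal{D})$ and $s$ a vertex of $t$, $t\bullet_st'$ is obtained by grafting all the roots of $t'$ on the vertex $s$ of $t$, the partition being the disjoint union of the partitions of $t$ and $t'$. One puts $t\bullet t'=\sum_{s\in V(t)}t\bullet_st'$, where $V(t)$ is the set of vertices of $t$. The partitioned tree $t\sqcup\!\sqcup t'$ is the disjoint union $tt'$ as a rooted forest, its partition being obtained from the disjoint union of the partitions of $t$ and $t'$ by merging the part formed by the roots of $t$ with the part formed by the roots of $t'$. Extended bilinearly, these products make $\mathfrak{g}_{\mathcal{PT}(\mathcal{D})}$ a Com-Prelie algebra. *)

theory Defs
  imports Complex_Main "HOL-Library.Poly_Mapping" "HOL-Library.Disjoint_Sets" "HOL-Library.FuncSet"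
begin

section \<open>Com-Prelie algebras\<close>

text \<open>The underlying vector space is a linear subspace \<open>A\<close> of an ambient vector space.\<close>

locale com_prelie = vector_space scale
  for scale :: "'k::field_char_0 \<Rightarrow> 'a::ab_group_add \<Rightarrow> 'a" +
  fixes A :: "'a set"
    and pre :: "'a \<Rightarrow> 'a \<Rightarrow> 'a"
    and sh :: "'a \<Rightarrow> 'a \<Rightarrow> 'a"
  assumes subspace: "subspace A"
    and pre_closed: "x \<in> A \<Longrightarrow> y \<in> A \<Longrightarrow> pre x y \<in> A"
    and pre_add_left: "x \<in> A \<Longrightarrow> y \<in> A \<Longrightarrow> z \<in> A \<Longrightarrow> pre (x + y) z = pre x z + pre y z"
    and pre_add_right: "x \<in> A \<Longrightarrow> y \<in> A \<Longrightarrow> z \<in> A \<Longrightarrow> pre x (y + z) = pre x y + pre x z"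
    and pre_scale_left: "x \<in> A \<Longrightarrow> y \<in> A \<Longrightarrow> pre (scale c x) y = scale c (pre x y)"
    and pre_scale_right: "x \<in> A \<Longrightarrow> y \<in> A \<Longrightarrow> pre x (scale c y) = scale c (pre x y)"
    and sh_closed: "x \<in> A \<Longrightarrow> y \<in> A \<Longrightarrow> sh x y \<in> A"
    and sh_add_left: "x \<in> A \<Longrightarrow> y \<in> A \<Longrightarrow> z \<in> A \<Longrightarrow> sh (x + y) z = sh x z + sh y z"
    and sh_add_right: "x \<in> A \<Longrightarrow> y \<in> A \<Longrightarrow> z \<in> A \<Longrightarrow> sh x (y + z) = sh x y + sh x z"
    and sh_scale_left: "x \<in> A \<Longrightarrow> y \<in> A \<Longrightarrow> sh (scale c x) y = scale c (sh x y)"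
    and sh_scale_right: "x \<in> A \<Longrightarrow> y \<in> A \<Longrightarrow> sh x (scale c y) = scale c (sh x y)"
    and prelie: "x \<in> A \<Longrightarrow> y \<in> A \<Longrightarrow> z \<in> A \<Longrightarrow>
      pre (pre x y) z - pre x (pre y z) = pre (pre x z) y - pre x (pre z y)"
    and sh_commute: "x \<in> A \<Longrightarrow> y \<in> A \<Longrightarrow> sh x y = sh y x"
    and sh_assoc: "x \<in> A \<Longrightarrow> y \<in> A \<Longrightarrow> z \<in> A \<Longrightarrow> sh (sh x y) z = sh x (sh y z)"
    and leibniz: "x \<in> A \<Longrightarrow> y \<in> A \<Longrightarrow> z \<in> A \<Longrightarrow>
      pre (sh x y) z = sh (pre x z) y + sh x (pre y z)"

locale com_prelie_hom =
  dom: com_prelie scaleA A preA shA +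
  cod: com_prelie scaleB B preB shB
  for scaleA :: "'k::field_char_0 \<Rightarrow> 'a::ab_group_add \<Rightarrow> 'a" and A preA shA
    and scaleB :: "'k \<Rightarrow> 'b::ab_group_add \<Rightarrow> 'b" and B preB shB +
  fixes \<phi> :: "'a \<Rightarrow> 'b"
  assumes map_into: "x \<in> A \<Longrightarrow> \<phi> x \<in> B"
    and map_add: "x \<in> A \<Longrightarrow> y \<in> A \<Longrightarrow> \<phi> (x + y) = \<phi> x + \<phi> y"
    and map_scale: "x \<in> A \<Longrightarrow> \<phi> (scaleA c x) = scaleB c (\<phi> x)"
    and map_pre: "x \<in> A \<Longrightarrow> y \<in> A \<Longrightarrow> \<phi> (preA x y) = preB (\<phi> x) (\<phi> y)"
    and map_sh: "x \<in> A \<Longrightarrow> y \<in> A \<Longrightarrow> \<phi> (shA x y) = shB (\<phi> x) (\<phi> y)"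


section \<open>Decorated partitioned forests\<close>

text \<open>An edge \<open>(v, w)\<close> goes from \<open>v\<close> down to its direct descendant \<open>w\<close>, towards the root.
  Values of \<open>dec\<close> outside \<open>verts\<close> are irrelevant.\<close>

record ('v, 'd) forest =
  verts :: "'v set"
  edges :: "('v \<times> 'v) set"
  parts :: "'v set set"
  dec :: "'v \<Rightarrow> 'd"

definition rooted_forest :: "('v, 'd) forest \<Rightarrow> bool" where
  "rooted_forest F \<longleftrightarrow> finite (verts F) \<and> edges F \<subseteq> verts F \<times> verts F \<and>
     single_valued (edges F) \<and> acyclic (edges F)"

definition roots :: "('v, 'd) forest \<Rightarrow> 'v set" where
  "roots F = {v \<in> verts F. \<forall>w. (v, w) \<notin> edges F}"

definition partitioned_forest :: "('v, 'd) forest \<Rightarrow> bool" where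
  "partitioned_forest F \<longleftrightarrow> rooted_forest F \<and> partition_on (verts F) (parts F) \<and>
     (\<forall>p\<in>parts F. \<forall>x\<in>p. \<forall>y\<in>p.
        x \<in> roots F \<and> y \<in> roots F \<or> (\<exists>z. (x, z) \<in> edges F \<and> (y, z) \<in> edges F))"

definition partitioned_tree :: "('v, 'd) forest \<Rightarrow> bool" where
  "partitioned_tree F \<longleftrightarrow> partitioned_forest F \<and> verts F \<noteq> {} \<and> (\<exists>p\<in>parts F. roots F \<subseteq> p)"

definition forest_iso :: "('v \<Rightarrow> 'w) \<Rightarrow> ('v, 'd) forest \<Rightarrow> ('w, 'd) forest \<Rightarrow> bool" where
  "forest_iso f F G \<longleftrightarrow> bij_betw f (verts F) (verts G) \<and>
     edges G = map_prod f f ` edges F \<and> parts G = (`) f ` parts F \<and>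
     (\<forall>v\<in>verts F. dec G (f v) = dec F v)"

text \<open>Every finite forest is isomorphic to one with vertices in \<^typ>\<open>nat\<close>, so isoclasses
  are represented by their members over \<^typ>\<open>nat\<close>.\<close>

definition isoclass :: "('v, 'd) forest \<Rightarrow> (nat, 'd) forest set" where
  "isoclass F = {G. \<exists>f. forest_iso f F G}"

definition rep :: "(nat, 'd) forest set \<Rightarrow> (nat, 'd) forest" where
  "rep t = (SOME F. F \<in> t)"

definition PT :: "'d set \<Rightarrow> (nat, 'd) forest set set" where
  "PT D = {isoclass F |F :: (nat, 'd) forest. partitioned_tree F \<and> dec F ` verts F \<subseteq> D}"

definition dot :: "'d \<Rightarrow> (nat, 'd) forest set" where
  "dot d = isoclass \<lparr>verts = {0::nat}, edges = {}, parts = {{0}}, dec = \<lambda>_. d\<rparr>"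

definition graft :: "'v \<Rightarrow> ('v, 'd) forest \<Rightarrow> ('w, 'd) forest \<Rightarrow> ('v + 'w, 'd) forest" where
  "graft s F G = \<lparr>verts = verts F <+> verts G,
     edges = map_prod Inl Inl ` edges F \<union> map_prod Inr Inr ` edges G
       \<union> (\<lambda>r. (Inr r, Inl s)) ` roots G,
     parts = (`) Inl ` parts F \<union> (`) Inr ` parts G,
     dec = case_sum (dec F) (dec G)\<rparr>"

text \<open>In a partitioned tree the part containing the roots is exactly \<^const>\<open>roots\<close>.\<close>

definition merge :: "('v, 'd) forest \<Rightarrow> ('w, 'd) forest \<Rightarrow> ('v + 'w, 'd) forest" where
  "merge F G = \<lparr>verts = verts F <+> verts G,
     edges = map_prod Inl Inl ` edges F \<union> map_prod Inr Inr ` edges G,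
     parts = insert (roots F <+> roots G)
       ((`) Inl ` (parts F - {roots F}) \<union> (`) Inr ` (parts G - {roots G})),
     dec = case_sum (dec F) (dec G)\<rparr>"


section \<open>The Com-Prelie algebra of partitioned trees\<close>

definition gPT :: "'d set \<Rightarrow> ((nat, 'd) forest set \<Rightarrow>\<^sub>0 'k::field_char_0) set" where
  "gPT D = {x. Poly_Mapping.keys x \<subseteq> PT D}"

definition g_scale :: "'k::field_char_0 \<Rightarrow> ('b \<Rightarrow>\<^sub>0 'k) \<Rightarrow> ('b \<Rightarrow>\<^sub>0 'k)" where
  "g_scale c = Poly_Mapping.map ((*) c)"

definition bilinear_ext :: "('b \<Rightarrow> 'b \<Rightarrow> ('b \<Rightarrow>\<^sub>0 'k::field_char_0)) \<Rightarrow>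
    ('b \<Rightarrow>\<^sub>0 'k) \<Rightarrow> ('b \<Rightarrow>\<^sub>0 'k) \<Rightarrow> ('b \<Rightarrow>\<^sub>0 'k)" where
  "bilinear_ext m x y = (\<Sum>t\<in>Poly_Mapping.keys x. \<Sum>u\<in>Poly_Mapping.keys y.
     g_scale (Poly_Mapping.lookup x t * Poly_Mapping.lookup y u) (m t u))"

definition pt_pre :: "(nat, 'd) forest set \<Rightarrow> (nat, 'd) forest set \<Rightarrow>
    ((nat, 'd) forest set \<Rightarrow>\<^sub>0 'k::field_char_0)" where
  "pt_pre t u = (\<Sum>s\<in>verts (rep t). Poly_Mapping.single (isoclass (graft s (rep t) (rep u))) 1)"

definition pt_sh :: "(nat, 'd) forest set \<Rightarrow> (nat, 'd) forest set \<Rightarrow> (nat, 'd) forest set" where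
  "pt_sh t u = isoclass (merge (rep t) (rep u))"

definition g_pre :: "((nat, 'd) forest set \<Rightarrow>\<^sub>0 'k::field_char_0) \<Rightarrow>
    ((nat, 'd) forest set \<Rightarrow>\<^sub>0 'k) \<Rightarrow> ((nat, 'd) forest set \<Rightarrow>\<^sub>0 'k)" where
  "g_pre = bilinear_ext pt_pre"

definition g_sh :: "((nat, 'd) forest set \<Rightarrow>\<^sub>0 'k::field_char_0) \<Rightarrow>
    ((nat, 'd) forest set \<Rightarrow>\<^sub>0 'k) \<Rightarrow> ((nat, 'd) forest set \<Rightarrow>\<^sub>0 'k)" where
  "g_sh = bilinear_ext (\<lambda>t u. Poly_Mapping.single (pt_sh t u) 1)"


section \<open>Independence of the chosen representatives\<close>

lemma forest_iso_id: "forest_iso id F F"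
  by (auto simp: forest_iso_def map_prod.id)

lemma forest_iso_trans:
  assumes f: "forest_iso f F G" and g: "forest_iso g G H"
  shows "forest_iso (g \<circ> f) F H"
proof -
  have "bij_betw (g \<circ> f) (verts F) (verts H)"
    using f g by (auto simp: forest_iso_def intro: bij_betw_trans)
  moreover have "edges H = map_prod (g \<circ> f) (g \<circ> f) ` edges F"
    using f g by (simp add: forest_iso_def image_image map_prod_def case_prod_unfold)
  moreover have "parts H = (`) (g \<circ> f) ` parts F"
    using f g by (simp add: forest_iso_def image_image)
  moreover have "\<forall>v\<in>verts F. dec H ((g \<circ> f) v) = dec F v"
    using f g by (auto simp: forest_iso_def dest: bij_betwE)
  ultimately show ?thesis by (simp add: forest_iso_def)
qed

lemma forest_iso_sym:
  assumes iso: "forest_iso f F G"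
    and E: "edges F \<subseteq> verts F \<times> verts F" and P: "\<Union>(parts F) \<subseteq> verts F"
  shows "forest_iso (inv_into (verts F) f) G F"
proof -
  let ?g = "inv_into (verts F) f"
  from iso have bij: "bij_betw f (verts F) (verts G)" and
    e: "edges G = map_prod f f ` edges F" and p: "parts G = (`) f ` parts F" and
    d: "\<And>v. v \<in> verts F \<Longrightarrow> dec G (f v) = dec F v"
    by (auto simp: forest_iso_def)
  have inv: "?g (f v) = v" if "v \<in> verts F" for v
    using bij that by (simp add: bij_betw_def)
  have inv2: "?g w \<in> verts F" "f (?g w) = w" if "w \<in> verts G" for w
    using bij that by (auto simp: bij_betw_def inv_into_into f_inv_into_f)
  have "map_prod ?g ?g ` edges G = (\<lambda>e. e) ` edges F"
    unfolding e image_image using E by (intro image_cong) (auto simp: inv)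
  moreover have "(`) ?g ` parts G = (\<lambda>p. p) ` parts F"
    unfolding p image_image
  proof (intro image_cong refl)
    fix q assume "q \<in> parts F"
    hence "q \<subseteq> verts F" using P by blast
    hence "(\<lambda>x. ?g (f x)) ` q = (\<lambda>x. x) ` q"
      by (intro image_cong) (auto simp: inv)
    thus "(\<lambda>x. ?g (f x)) ` q = q" by simp
  qed
  moreover have "dec F (?g w) = dec G w" if "w \<in> verts G" for w
    using d[OF inv2(1)[OF that]] inv2(2)[OF that] by simp
  ultimately show ?thesis
    using bij_betw_inv_into[OF bij] by (simp add: forest_iso_def)
qed

lemma partitioned_forest_wf:
  assumes "partitioned_forest F"
  shows "finite (verts F)" "edges F \<subseteq> verts F \<times> verts F" "\<Union>(parts F) = verts F"
  using assms by (auto simp: partitioned_forest_def rooted_forest_def partition_on_def)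

lemma isoclass_cong:
  assumes "forest_iso f F G" "edges F \<subseteq> verts F \<times> verts F" "\<Union>(parts F) \<subseteq> verts F"
  shows "isoclass F = isoclass G"
  using assms(1) forest_iso_sym[OF assms] by (auto simp: isoclass_def intro: forest_iso_trans)

lemma ex_nat_iso:
  assumes "finite (verts F)"
  shows "\<exists>G :: (nat, 'd) forest. G \<in> isoclass (F :: ('v, 'd) forest)"
proof -
  obtain f :: "'v \<Rightarrow> nat" where f: "inj_on f (verts F)"
    using finite_imp_inj_to_nat_seg[OF assms] by blast
  define G :: "(nat, 'd) forest" where
    "G = \<lparr>verts = f ` verts F, edges = map_prod f f ` edges F, parts = (`) f ` parts F,
      dec = \<lambda>n. dec F (inv_into (verts F) f n)\<rparr>"
  have "forest_iso f F G"
    using f by (auto simp: forest_iso_def G_def bij_betw_def)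
  then show ?thesis by (auto simp: isoclass_def)
qed

lemma rep_iso:
  assumes "partitioned_forest F"
  shows "\<exists>f. forest_iso f F (rep (isoclass F))"
proof -
  have "rep (isoclass F) \<in> isoclass F"
    unfolding rep_def by (rule someI_ex[OF ex_nat_iso[OF partitioned_forest_wf(1)[OF assms]]])
  then show ?thesis by (simp add: isoclass_def)
qed

lemma forest_iso_roots:
  assumes iso: "forest_iso f F G" and E: "edges F \<subseteq> verts F \<times> verts F"
  shows "roots G = f ` roots F"
proof -
  from iso have inj: "inj_on f (verts F)" and im: "verts G = f ` verts F"
    and e: "edges G = map_prod f f ` edges F"
    by (auto simp: forest_iso_def bij_betw_def)
  have "(\<exists>w. (f v, w) \<in> edges G) \<longleftrightarrow> (\<exists>w. (v, w) \<in> edges F)" if v: "v \<in> verts F" for v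
  proof
    assume "\<exists>w. (f v, w) \<in> edges G"
    then obtain v' w' where "(v', w') \<in> edges F" "f v' = f v"
      by (auto simp: e)
    moreover from this E v inj_onD[OF inj, of v' v] have "v' = v" by blast
    ultimately show "\<exists>w. (v, w) \<in> edges F" by blast
  qed (force simp: e)
  then show ?thesis
    unfolding roots_def im by blast
qed

lemma roots_in_parts:
  assumes "partitioned_tree F"
  shows "roots F \<in> parts F"
proof -
  from assms obtain p where p: "p \<in> parts F" "roots F \<subseteq> p" and
    cond: "\<And>x y. x \<in> p \<Longrightarrow> y \<in> p \<Longrightarrow>
       x \<in> roots F \<and> y \<in> roots F \<or> (\<exists>z. (x, z) \<in> edges F \<and> (y, z) \<in> edges F)"
    and ac: "acyclic (edges F)" and fin: "finite (verts F)" and ne: "verts F \<noteq> {}"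
    and E: "edges F \<subseteq> verts F \<times> verts F"
    by (auto simp: partitioned_tree_def partitioned_forest_def rooted_forest_def)
  have "finite (edges F)" using E fin by (meson finite_SigmaI finite_subset)
  then have "wf ((edges F)\<inverse>)" using ac by (rule finite_acyclic_wf_converse)
  then obtain r where r: "r \<in> verts F" "\<And>y. (y, r) \<in> (edges F)\<inverse> \<Longrightarrow> y \<notin> verts F"
    using ne by (meson ex_in_conv wfE_min)
  then have "r \<in> roots F" using E by (auto simp: roots_def)
  have "x \<in> roots F" if "x \<in> p" for x
  proof -
    have "(r, z) \<notin> edges F" for z using \<open>r \<in> roots F\<close> by (simp add: roots_def)
    moreover have "r \<in> p" using \<open>r \<in> roots F\<close> p(2) by blast
    ultimately show ?thesis using cond[OF that, of r] by blast
  qed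
  then have "p = roots F" using p(2) by blast
  then show ?thesis using p(1) by simp
qed

lemma bij_betw_map_sum:
  assumes "bij_betw f A A'" "bij_betw g B B'"
  shows "bij_betw (map_sum f g) (A <+> B) (A' <+> B')"
proof (rule bij_betw_imageI)
  show "inj_on (map_sum f g) (A <+> B)"
    using assms by (intro inj_onI) (auto simp: bij_betw_def dest: inj_onD)
  show "map_sum f g ` (A <+> B) = A' <+> B'"
    unfolding assms[THEN bij_betw_imp_surj_on, symmetric]
    by (simp add: Plus_def image_Un image_image)
qed

lemma forest_iso_graft:
  assumes f: "forest_iso f F F'" and g: "forest_iso g G G'"
    and E: "edges G \<subseteq> verts G \<times> verts G"
  shows "forest_iso (map_sum f g) (graft s F G) (graft (f s) F' G')"
proof -
  have r: "roots G' = g ` roots G" by (rule forest_iso_roots[OF g E])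
  have e: "edges F' = map_prod f f ` edges F" "edges G' = map_prod g g ` edges G"
    and p: "parts F' = (`) f ` parts F" "parts G' = (`) g ` parts G"
    using f g by (simp_all add: forest_iso_def)
  show ?thesis
    unfolding forest_iso_def
  proof (intro conjI)
    show "bij_betw (map_sum f g) (verts (graft s F G)) (verts (graft (f s) F' G'))"
      using f g by (simp add: graft_def forest_iso_def bij_betw_map_sum)
    show "edges (graft (f s) F' G') =
        map_prod (map_sum f g) (map_sum f g) ` edges (graft s F G)"
      by (simp add: graft_def e r image_Un image_image map_prod_def case_prod_unfold)
    show "parts (graft (f s) F' G') = (`) (map_sum f g) ` parts (graft s F G)"
      by (simp add: graft_def p image_Un image_image)
    show "\<forall>v\<in>verts (graft s F G).
        dec (graft (f s) F' G') (map_sum f g v) = dec (graft s F G) v"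
      using f g by (auto simp: graft_def forest_iso_def)
  qed
qed

lemma parts_minus_roots:
  assumes f: "forest_iso f F F'" and F: "partitioned_tree F"
  shows "parts F' - {roots F'} = (`) f ` (parts F - {roots F})"
proof -
  have wf: "edges F \<subseteq> verts F \<times> verts F" "\<Union>(parts F) = verts F"
    using F by (simp_all add: partitioned_tree_def partitioned_forest_wf)
  have "inj_on f (\<Union>(parts F))"
    using f wf(2) by (simp add: forest_iso_def bij_betw_def)
  then have "inj_on ((`) f) (parts F)" by (rule inj_on_image)
  from inj_on_image_set_diff[OF this, of "parts F" "{roots F}"] roots_in_parts[OF F]
  show ?thesis
    using f by (auto simp: forest_iso_def forest_iso_roots[OF f wf(1)])
qed

lemma forest_iso_merge:
  assumes f: "forest_iso f F F'" and g: "forest_iso g G G'"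
    and F: "partitioned_tree F" and G: "partitioned_tree G"
  shows "forest_iso (map_sum f g) (merge F G) (merge F' G')"
proof -
  have wf: "edges F \<subseteq> verts F \<times> verts F" "edges G \<subseteq> verts G \<times> verts G"
    using F G by (simp_all add: partitioned_tree_def partitioned_forest_wf)
  have e: "edges F' = map_prod f f ` edges F" "edges G' = map_prod g g ` edges G"
    using f g by (simp_all add: forest_iso_def)
  have r: "roots F' <+> roots G' = map_sum f g ` (roots F <+> roots G)"
    by (simp add: forest_iso_roots[OF f wf(1)] forest_iso_roots[OF g wf(2)]
        Plus_def image_Un image_image)
  show ?thesis
    unfolding forest_iso_def
  proof (intro conjI)
    show "bij_betw (map_sum f g) (verts (merge F G)) (verts (merge F' G'))"
      using f g by (simp add: merge_def forest_iso_def bij_betw_map_sum)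
    show "edges (merge F' G') = map_prod (map_sum f g) (map_sum f g) ` edges (merge F G)"
      by (simp add: merge_def e image_Un image_image map_prod_def case_prod_unfold)
    show "parts (merge F' G') = (`) (map_sum f g) ` parts (merge F G)"
      by (simp add: merge_def r parts_minus_roots[OF f F] parts_minus_roots[OF g G]
          image_Un image_image)
    show "\<forall>v\<in>verts (merge F G). dec (merge F' G') (map_sum f g v) = dec (merge F G) v"
      using f g by (auto simp: merge_def forest_iso_def)
  qed
qed

lemma pt_pre_isoclass:
  assumes F: "partitioned_tree F" and G: "partitioned_tree G"
  shows "pt_pre (isoclass F) (isoclass G) =
    (\<Sum>s\<in>verts F. Poly_Mapping.single (isoclass (graft s F G)) 1)"
proof -
  have pf: "partitioned_forest F" "partitioned_forest G"
    using F G by (simp_all add: partitioned_tree_def)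
  note wf = pf[THEN partitioned_forest_wf(2)] pf[THEN partitioned_forest_wf(3)]
  obtain f g where f: "forest_iso f F (rep (isoclass F))"
    and g: "forest_iso g G (rep (isoclass G))"
    using pf[THEN rep_iso] by blast
  have cls: "isoclass (graft s F G) = isoclass (graft (f s) (rep (isoclass F)) (rep (isoclass G)))"
    if s: "s \<in> verts F" for s
  proof (rule isoclass_cong[OF forest_iso_graft[OF f g wf(2)]])
    show "edges (graft s F G) \<subseteq> verts (graft s F G) \<times> verts (graft s F G)"
      using wf(1,2) s by (auto simp: graft_def roots_def)
    show "\<Union>(parts (graft s F G)) \<subseteq> verts (graft s F G)"
      using wf(3,4) by (auto simp: graft_def)
  qed
  have bij: "bij_betw f (verts F) (verts (rep (isoclass F)))"
    using f by (simp add: forest_iso_def)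
  show ?thesis
    unfolding pt_pre_def sum.reindex_bij_betw[OF bij, symmetric]
    by (rule sum.cong) (simp_all add: cls)
qed

lemma pt_sh_isoclass:
  assumes F: "partitioned_tree F" and G: "partitioned_tree G"
  shows "pt_sh (isoclass F) (isoclass G) = isoclass (merge F G)"
proof -
  have pf: "partitioned_forest F" "partitioned_forest G"
    using F G by (simp_all add: partitioned_tree_def)
  note wf = pf[THEN partitioned_forest_wf(2)] pf[THEN partitioned_forest_wf(3)]
  obtain f g where f: "forest_iso f F (rep (isoclass F))"
    and g: "forest_iso g G (rep (isoclass G))"
    using pf[THEN rep_iso] by blast
  have "isoclass (merge F G) = isoclass (merge (rep (isoclass F)) (rep (isoclass G)))"
  proof (rule isoclass_cong[OF forest_iso_merge[OF f g F G]])
    show "edges (merge F G) \<subseteq> verts (merge F G) \<times> verts (merge F G)"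
      using wf(1,2) by (auto simp: merge_def)
    show "\<Union>(parts (merge F G)) \<subseteq> verts (merge F G)"
      using wf(3,4) by (auto simp: merge_def roots_def)
  qed
  then show ?thesis by (simp add: pt_sh_def)
qed

end

theory Submission
  imports Defs
begin

text \<open>
Existence. Composing with a linear projection onto \<open>A\<close> makes both products of the target total.
Attach to every vertex \<open>v\<close> of a partitioned tree a value in \<open>A\<close>: if \<open>p\<^sub>1, \<dots>, p\<^sub>k\<close> are the parts
of the set of children of \<open>v\<close>, it is the symmetric brace \<open>a\<^sub>d{x\<^sub>1, \<dots>, x\<^sub>k}\<close> of Oudom and Guin, where
\<open>d\<close> decorates \<open>v\<close> and \<open>x\<^sub>i\<close> is the commutative product of the values of the vertices in \<open>p\<^sub>i\<close>. The value
of a tree is the commutative product of the values of its roots. Compatibility with \<open>\<bullet>\<close> follows,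
vertex by vertex, from the Leibniz rule and from the recursion
\<open>a{x\<^sub>1, \<dots>, x\<^sub>k, y} = a{x\<^sub>1, \<dots>, x\<^sub>k} \<bullet> y - \<Sum>\<^sub>i a{x\<^sub>1, \<dots>, x\<^sub>i \<bullet> y, \<dots>, x\<^sub>k}\<close> defining the braces.

Uniqueness. A tree with several roots is a product of two smaller trees. A tree with one root \<open>r\<close>
and more than one vertex occurs in \<open>F\<^sub>1 \<bullet> F\<^sub>2\<close>, where \<open>F\<^sub>2\<close> consists of a part of the children of \<open>r\<close>
and everything above it; the other terms have the same size, but fewer children at the root.
\<close>

section \<open>Partitioned trees up to isomorphism\<close>

text \<open>Why braces: right multiplication by the value of \<open>G\<close> has to equal the sum
  over all ways to graft \<open>G\<close>. At a vertex \<open>v\<close>, the grafts strictly above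
  \<open>v\<close> are accounted for by letting the new value act on one argument at a time; what is
  left must be the graft on \<open>v\<close> itself, where the roots of \<open>G\<close> form one
  additional part of the children. The recursion of the braces is this equation solved for the graft
  on \<open>v\<close>. Since the parts of the children carry no order, the result must not depend on
  the order in which arguments are inserted, and this is where the prelie identity of the target is
  used. The obstacle on the side of trees is the type of vertices: grafts and merges live on sum
  types, while classes are represented over \<open>nat\<close>. Hence the constructions on trees are
  polymorphic in the vertices and invariant under isomorphism, and the identities of the algebra
  become explicit bijections between iterated sums.\<close>

lemma partition_on_eq: "partition_on A P \<Longrightarrow> p \<in> P \<Longrightarrow> q \<in> P \<Longrightarrow> x \<in> p \<Longrightarrow> x \<in> q \<Longrightarrow> p = q"
  by (meson disjoint_iff disjointD partition_onD2)

lemma partition_on_map: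
  assumes "partition_on A P" "inj_on f A"
  shows "partition_on (f ` A) ((`) f ` P)"
  using partition_on_inj_image[OF assms] partition_onD3[OF assms(1)]
  by (metis Diff_empty Diff_insert0 image_iff image_is_empty)

lemma partition_on_union:
  assumes "partition_on A P" "partition_on B Q" "A \<inter> B = {}"
  shows "partition_on (A \<union> B) (P \<union> Q)"
proof (rule partition_onI)
  show "\<Union>(P \<union> Q) = A \<union> B" "{} \<notin> P \<union> Q"
    using assms(1,2) by (auto simp: partition_on_def)
  fix p q assume "p \<in> P \<union> Q" "q \<in> P \<union> Q" "p \<noteq> q"
  then show "disjnt p q"
    using partition_on_eq[OF assms(1)] partition_on_eq[OF assms(2)] partition_onD1[OF assms(1)]
      partition_onD1[OF assms(2)] assms(3) unfolding disjnt_iff by blast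
qed

lemma partition_on_remove:
  assumes "partition_on A P" "p \<in> P"
  shows "partition_on (A - p) (P - {p})"
proof -
  have "disjnt p (\<Union>(P - {p}))"
    using partition_on_eq[OF assms(1) assms(2)] by (auto simp: disjnt_iff)
  from partition_on_insert[OF this, of A] show ?thesis
    using assms by (simp add: insert_absorb)
qed

lemma partitioned_forest_wf_edges:
  assumes "partitioned_forest F"
  shows "wf (edges F)"
proof -
  have "finite (edges F)"
    using partitioned_forest_wf(1,2)[OF assms] by (meson finite_SigmaI finite_subset)
  then show ?thesis
    using assms by (simp add: partitioned_forest_def rooted_forest_def finite_acyclic_wf)
qed

text \<open>The two alternatives of the definition are separated here: \<open>roots F\<close> is
  itself a part, and every other part sits over a common vertex. Well-foundedness of
  \<open>edges F\<close> replaces acyclicity, so that children precede their parent in inductions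
  and recursions.\<close>

lemma partitioned_treeI:
  assumes "finite (verts F)" "edges F \<subseteq> verts F \<times> verts F" "single_valued (edges F)" "wf (edges F)"
    and "partition_on (verts F) (parts F)" "roots F \<in> parts F"
    and "\<And>p x y. p \<in> parts F \<Longrightarrow> p \<noteq> roots F \<Longrightarrow> x \<in> p \<Longrightarrow> y \<in> p \<Longrightarrow>
      \<exists>z. (x, z) \<in> edges F \<and> (y, z) \<in> edges F"
  shows "partitioned_tree F"
proof -
  have "verts F \<noteq> {}" using assms(5,6) by (metis empty_iff partition_on_empty)
  moreover have "x \<in> roots F \<and> y \<in> roots F \<or> (\<exists>z. (x, z) \<in> edges F \<and> (y, z) \<in> edges F)"
    if "p \<in> parts F" "x \<in> p" "y \<in> p" for p x y
    using assms(7)[OF that(1) _ that(2,3)] that by (cases "p = roots F") auto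
  ultimately show ?thesis
    using assms by (auto simp: partitioned_tree_def partitioned_forest_def rooted_forest_def wf_acyclic)
qed

lemma partitioned_treeD:
  assumes "partitioned_tree F"
  shows "finite (verts F)" "edges F \<subseteq> verts F \<times> verts F" "single_valued (edges F)" "wf (edges F)"
    "partition_on (verts F) (parts F)" "roots F \<in> parts F" "roots F \<noteq> {}"
    "\<And>p x y. p \<in> parts F \<Longrightarrow> p \<noteq> roots F \<Longrightarrow> x \<in> p \<Longrightarrow> y \<in> p \<Longrightarrow>
      \<exists>z. (x, z) \<in> edges F \<and> (y, z) \<in> edges F"
proof -
  have pf: "partitioned_forest F" using assms by (simp add: partitioned_tree_def)
  then show "finite (verts F)" "edges F \<subseteq> verts F \<times> verts F" "single_valued (edges F)" "wf (edges F)"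
    and po: "partition_on (verts F) (parts F)"
    by (simp_all add: partitioned_forest_wf partitioned_forest_wf_edges)
      (simp_all add: partitioned_forest_def rooted_forest_def)
  show r: "roots F \<in> parts F" by (rule roots_in_parts[OF assms])
  then show "roots F \<noteq> {}" using po by (auto simp: partition_on_def)
  fix p x y assume p: "p \<in> parts F" "p \<noteq> roots F" "x \<in> p" "y \<in> p"
  then have "x \<notin> roots F" using r partition_on_eq[OF po] by blast
  then show "\<exists>z. (x, z) \<in> edges F \<and> (y, z) \<in> edges F"
    using pf p unfolding partitioned_forest_def by blast
qed

lemma partitioned_tree_iso:
  assumes iso: "forest_iso f F G" and F: "partitioned_tree F"
  shows "partitioned_tree G"
proof -
  note F = partitioned_treeD[OF F]
  let ?g = "inv_into (verts F) f"
  from iso have bij: "bij_betw f (verts F) (verts G)" and inj: "inj_on f (verts F)"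
    and V: "verts G = f ` verts F"
    and e: "edges G = map_prod f f ` edges F" and p: "parts G = (`) f ` parts F"
    by (auto simp: forest_iso_def bij_betw_def)
  have r: "roots G = f ` roots F" by (rule forest_iso_roots[OF iso F(2)])
  show ?thesis
  proof (rule partitioned_treeI)
    show "finite (verts G)" "edges G \<subseteq> verts G \<times> verts G" using F(1,2) by (auto simp: V e)
    show "single_valued (edges G)"
    proof (rule single_valuedI)
      fix x y z assume "(x, y) \<in> edges G" "(x, z) \<in> edges G"
      then obtain x1 y' x2 z' where "(x1, y') \<in> edges F" "(x2, z') \<in> edges F"
        "f x1 = x" "f x2 = x" "f y' = y" "f z' = z" by (auto simp: e)
      moreover from this have "x1 = x2" using F(2) by (intro inj_onD[OF inj]) auto
      ultimately show "y = z" using F(3) by (auto dest: single_valuedD)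
    qed
    have "edges G \<subseteq> inv_image (edges F) ?g"
      using F(2) inj by (auto simp: e)
    then show "wf (edges G)" using F(4) by (meson wf_inv_image wf_subset)
    show "partition_on (verts G) (parts G)"
      unfolding V p by (rule partition_on_map[OF F(5) inj])
    show "roots G \<in> parts G" using F(6) by (simp add: r p)
    fix q x y assume "q \<in> parts G" "q \<noteq> roots G" "x \<in> q" "y \<in> q"
    then obtain q' x' y' where "q' \<in> parts F" "q' \<noteq> roots F" "x' \<in> q'" "y' \<in> q'" "x = f x'" "y = f y'"
      unfolding p r by blast
    then show "\<exists>z. (x, z) \<in> edges G \<and> (y, z) \<in> edges G"
      using F(8)[of q' x' y'] unfolding e by force
  qed
qed

section \<open>Grafts and merges are partitioned trees\<close>

lemma inj_image_Inl: "inj_on ((`) Inl) X"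
  by (auto intro!: inj_onI simp: inj_image_eq_iff)

text \<open>A descending chain passes from the left summand to the right at most once, through
  \<open>c\<close>, and never comes back. A graft takes for \<open>c\<close> the edges from the
  roots of the upper tree, a merge the empty set.\<close>

lemma wf_Plus:
  fixes r :: "('v \<times> 'v) set" and s :: "('w \<times> 'w) set" and c :: "('w \<times> 'v) set"
  assumes "wf r" "wf s"
  shows "wf (map_prod Inl Inl ` r \<union> map_prod Inr Inr ` s \<union> map_prod Inr Inl ` c)"
proof -
  have c: "wf (map_prod Inr Inl ` c :: (('v + 'w) \<times> ('v + 'w)) set)"
    by (rule wf_subset[OF wf_measure[of "case_sum (\<lambda>_. 1) (\<lambda>_. 0)"]]) auto
  have "wf (map_prod Inl Inl ` r :: (('v + 'w) \<times> ('v + 'w)) set)"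
    "wf (map_prod Inr Inr ` s :: (('v + 'w) \<times> ('v + 'w)) set)"
    using assms by (auto intro!: wf_map_prod_image)
  then have "wf (map_prod Inr Inr ` s \<union> (map_prod Inr Inl ` c \<union> map_prod Inl Inl ` r)
      :: (('v + 'w) \<times> ('v + 'w)) set)"
    using c by (intro wf_Un) auto
  then show ?thesis by (simp add: Un_ac)
qed

lemma partition_on_Plus:
  assumes "partition_on A P" "partition_on B Q"
  shows "partition_on (A <+> B) ((`) Inl ` P \<union> (`) Inr ` Q)"
  unfolding Plus_def
  by (intro partition_on_union partition_on_map assms) auto

lemma graft_sel [simp]:
  "verts (graft s F G) = verts F <+> verts G"
  "parts (graft s F G) = (`) Inl ` parts F \<union> (`) Inr ` parts G"
  "dec (graft s F G) = case_sum (dec F) (dec G)"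
  by (simp_all add: graft_def)

lemma edges_graft [simp]:
  "(Inl x, Inl y) \<in> edges (graft s F G) \<longleftrightarrow> (x, y) \<in> edges F"
  "(Inr u, Inr w) \<in> edges (graft s F G) \<longleftrightarrow> (u, w) \<in> edges G"
  "(Inr u, Inl y) \<in> edges (graft s F G) \<longleftrightarrow> u \<in> roots G \<and> y = s"
  "(Inl x, Inr w) \<notin> edges (graft s F G)"
  by (auto simp: graft_def)

lemma merge_sel [simp]:
  "verts (merge F G) = verts F <+> verts G"
  "parts (merge F G) = insert (roots F <+> roots G)
     ((`) Inl ` (parts F - {roots F}) \<union> (`) Inr ` (parts G - {roots G}))"
  "dec (merge F G) = case_sum (dec F) (dec G)"
  by (simp_all add: merge_def)

lemma edges_merge [simp]:
  "(Inl x, Inl y) \<in> edges (merge F G) \<longleftrightarrow> (x, y) \<in> edges F"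
  "(Inr u, Inr w) \<in> edges (merge F G) \<longleftrightarrow> (u, w) \<in> edges G"
  "(Inr u, Inl y) \<notin> edges (merge F G)"
  "(Inl x, Inr w) \<notin> edges (merge F G)"
  by (auto simp: merge_def)

context
  fixes F :: "('v, 'd) forest" and G :: "('w, 'd) forest"
  assumes F: "partitioned_tree F" and G: "partitioned_tree G"
begin

lemma roots_graft: "roots (graft s F G) = Inl ` roots F"
proof (intro set_eqI)
  fix v
  \<comment> \<open>No vertex of \<open>G\<close> stays a root: it keeps its edge in
    \<open>G\<close> or acquires one to \<open>s\<close>.\<close>
  have "\<exists>w. (u, w) \<in> edges G \<or> u \<in> roots G" if "u \<in> verts G" for u
    using that by (auto simp: roots_def)
  then show "v \<in> roots (graft s F G) \<longleftrightarrow> v \<in> Inl ` roots F"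
    by (cases v) (auto simp: roots_def[of "graft s F G"] roots_def[of F] split_sum_all)
qed

lemma roots_merge: "roots (merge F G) = roots F <+> roots G"
proof (intro set_eqI)
  fix v show "v \<in> roots (merge F G) \<longleftrightarrow> v \<in> roots F <+> roots G"
    by (cases v) (auto simp: roots_def split_sum_all)
qed

lemma partitioned_tree_graft:
  assumes s: "s \<in> verts F"
  shows "partitioned_tree (graft s F G)"
proof -
  note F' = partitioned_treeD[OF F] and G' = partitioned_treeD[OF G]
  show ?thesis
  proof (rule partitioned_treeI, unfold roots_graft)
    show "finite (verts (graft s F G))" using F'(1) G'(1) by (simp add: graft_def)
    show "edges (graft s F G) \<subseteq> verts (graft s F G) \<times> verts (graft s F G)"
      using F'(2) G'(2) s by (auto simp: graft_def roots_def)
    show "single_valued (edges (graft s F G))"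
      using F'(3) G'(3) by (auto simp: single_valued_def graft_def roots_def)
    have "edges (graft s F G) = map_prod Inl Inl ` edges F \<union> map_prod Inr Inr ` edges G
       \<union> map_prod Inr Inl ` (roots G \<times> {s})"
      by (auto simp: graft_def)
    then show "wf (edges (graft s F G))" using wf_Plus[OF F'(4) G'(4)] by metis
    show "partition_on (verts (graft s F G)) (parts (graft s F G))"
      using partition_on_Plus[OF F'(5) G'(5)] by (simp add: graft_def)
    show "Inl ` roots F \<in> parts (graft s F G)" using F'(6) by (simp add: graft_def)
    fix p x y assume "p \<in> parts (graft s F G)" and ne: "p \<noteq> Inl ` roots F" and x: "x \<in> p" and y: "y \<in> p"
    then consider q where "q \<in> parts F" "p = Inl ` q" | q where "q \<in> parts G" "p = Inr ` q"
      by (auto simp: graft_def)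
    then show "\<exists>z. (x, z) \<in> edges (graft s F G) \<and> (y, z) \<in> edges (graft s F G)"
    proof cases
      case 1
      then obtain x' y' where "x = Inl x'" "y = Inl y'" "x' \<in> q" "y' \<in> q" using x y by auto
      then show ?thesis using F'(8)[of q x' y'] ne 1 by (force simp: graft_def)
    next
      case 2
      then obtain x' y' where "x = Inr x'" "y = Inr y'" "x' \<in> q" "y' \<in> q" using x y by auto
      then show ?thesis using G'(8)[of q x' y'] 2 by (cases "q = roots G") (force simp: graft_def)+
    qed
  qed
qed

lemma partitioned_tree_merge: "partitioned_tree (merge F G)"
proof -
  note F' = partitioned_treeD[OF F] and G' = partitioned_treeD[OF G]
  show ?thesis
  proof (rule partitioned_treeI, unfold roots_merge)
    show "finite (verts (merge F G))" using F'(1) G'(1) by (simp add: merge_def)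
    show "edges (merge F G) \<subseteq> verts (merge F G) \<times> verts (merge F G)"
      using F'(2) G'(2) by (auto simp: merge_def roots_def)
    show "single_valued (edges (merge F G))"
      using F'(3) G'(3) by (auto simp: single_valued_def merge_def)
    show "wf (edges (merge F G))" using wf_Plus[OF F'(4) G'(4), of "{}"] by (simp add: merge_def)
    show "partition_on (verts (merge F G)) (parts (merge F G))"
    proof -
      have "partition_on (verts F - roots F) (parts F - {roots F})"
        "partition_on (verts G - roots G) (parts G - {roots G})"
        using F'(5,6) G'(5,6) by (simp_all add: partition_on_remove)
      from partition_on_Plus[OF this]
      have "partition_on (((verts F - roots F) <+> (verts G - roots G)) \<union> (roots F <+> roots G))
        (((`) Inl ` (parts F - {roots F}) \<union> (`) Inr ` (parts G - {roots G})) \<union> {roots F <+> roots G})"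
        using F'(7) by (intro partition_on_union partition_on_space) auto
      moreover have "((verts F - roots F) <+> (verts G - roots G)) \<union> (roots F <+> roots G) = verts (merge F G)"
        by (auto simp: merge_def roots_def)
      ultimately show ?thesis by (simp add: merge_def)
    qed
    show "roots F <+> roots G \<in> parts (merge F G)" by (simp add: merge_def)
    fix p x y assume "p \<in> parts (merge F G)" "p \<noteq> roots F <+> roots G" and x: "x \<in> p" and y: "y \<in> p"
    then consider q where "q \<in> parts F" "q \<noteq> roots F" "p = Inl ` q"
      | q where "q \<in> parts G" "q \<noteq> roots G" "p = Inr ` q"
      by (auto simp: merge_def)
    then show "\<exists>z. (x, z) \<in> edges (merge F G) \<and> (y, z) \<in> edges (merge F G)"
    proof cases
      case 1
      then obtain x' y' where "x = Inl x'" "y = Inl y'" "x' \<in> q" "y' \<in> q" using x y by auto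
      then show ?thesis using F'(8)[of q x' y'] 1 by (force simp: merge_def)
    next
      case 2
      then obtain x' y' where "x = Inr x'" "y = Inr y'" "x' \<in> q" "y' \<in> q" using x y by auto
      then show ?thesis using G'(8)[of q x' y'] 2 by (force simp: merge_def)
    qed
  qed
qed

text \<open>Both root sets are nonempty, so the merged part meets both summands and is not the image
  of a part of either tree. This computes the partition of iterated merges.\<close>

lemma parts_merge_minus_roots: "parts (merge F G) - {roots F <+> roots G}
    = (`) Inl ` (parts F - {roots F}) \<union> (`) Inr ` (parts G - {roots G})"
proof -
  have "roots F <+> roots G \<noteq> Inl ` p" for p :: "'v set"
    using partitioned_treeD(7)[OF G] by blast
  moreover have "roots F <+> roots G \<noteq> Inr ` p" for p :: "'w set"
    using partitioned_treeD(7)[OF F] by blast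
  ultimately show ?thesis by auto
qed

lemma dec_graft: "dec (graft s F G) ` verts (graft s F G) = dec F ` verts F \<union> dec G ` verts G"
  by (simp add: graft_def Plus_def image_Un image_image)

lemma dec_merge: "dec (merge F G) ` verts (merge F G) = dec F ` verts F \<union> dec G ` verts G"
  by (simp add: merge_def Plus_def image_Un image_image)

end

section \<open>Isoclasses and their representatives\<close>

lemma isoclass_eqI:
  assumes "forest_iso f F G" "partitioned_tree F"
  shows "isoclass F = isoclass G"
  using assms(1) by (rule isoclass_cong) (use partitioned_treeD[OF assms(2)] in \<open>auto simp: partition_on_def\<close>)

lemma forest_iso_dec:
  assumes "forest_iso f F G"
  shows "dec G ` verts G = dec F ` verts F"
proof -
  have "verts G = f ` verts F" using assms by (simp add: forest_iso_def bij_betw_def)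
  then have "dec G ` verts G = (\<lambda>v. dec G (f v)) ` verts F" by (simp add: image_image)
  also have "\<dots> = dec F ` verts F" using assms by (intro image_cong) (auto simp: forest_iso_def)
  finally show ?thesis .
qed

text \<open>\<open>PT\<close> ranges over forests on \<open>nat\<close>, but grafts and merges have
  vertices in sum types; an isomorphic copy on \<open>nat\<close> bridges the two.\<close>

lemma isoclass_in_PT:
  fixes F :: "('v, 'd) forest" and D :: "'d set"
  assumes F: "partitioned_tree F" and D: "dec F ` verts F \<subseteq> D"
  shows "isoclass F \<in> PT D"
proof -
  obtain G :: "(nat, 'd) forest" and f where f: "forest_iso f F G"
    using ex_nat_iso[OF partitioned_treeD(1)[OF F]] by (auto simp: isoclass_def)
  have "dec G ` verts G \<subseteq> D" using D forest_iso_dec[OF f] by simp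
  then show ?thesis
    using isoclass_eqI[OF f F] partitioned_tree_iso[OF f F] by (auto simp: PT_def)
qed

lemma rep_PT:
  fixes D :: "'d set"
  assumes "t \<in> PT D"
  shows "partitioned_tree (rep t)" "dec (rep t) ` verts (rep t) \<subseteq> D" "isoclass (rep t) = t"
proof -
  obtain F :: "(nat, 'd) forest" where F: "partitioned_tree F" "dec F ` verts F \<subseteq> D" "t = isoclass F"
    using assms by (auto simp: PT_def)
  obtain f where f: "forest_iso f F (rep t)"
    using rep_iso[of F] F by (auto simp: partitioned_tree_def)
  show "partitioned_tree (rep t)" by (rule partitioned_tree_iso[OF f F(1)])
  show "isoclass (rep t) = t" using isoclass_eqI[OF f F(1)] F(3) by (rule trans[OF sym sym])
  show "dec (rep t) ` verts (rep t) \<subseteq> D"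
    using F(2) forest_iso_dec[OF f] by simp
qed

section \<open>Isomorphisms behind the Com-Prelie identities\<close>

definition sum_assoc :: "('u + 'v) + 'w \<Rightarrow> 'u + ('v + 'w)" where
  "sum_assoc = case_sum (case_sum Inl (Inr \<circ> Inl)) (Inr \<circ> Inr)"

definition sum_exchange :: "('u + 'v) + 'w \<Rightarrow> ('u + 'w) + 'v" where
  "sum_exchange = case_sum (case_sum (Inl \<circ> Inl) Inr) (Inl \<circ> Inr)"

lemma sum_assoc_simps [simp]:
  "sum_assoc (Inl (Inl x)) = Inl x" "sum_assoc (Inl (Inr y)) = Inr (Inl y)" "sum_assoc (Inr z) = Inr (Inr z)"
  by (simp_all add: sum_assoc_def)

lemma sum_exchange_simps [simp]:
  "sum_exchange (Inl (Inl x)) = Inl (Inl x)" "sum_exchange (Inl (Inr y)) = Inr y"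
  "sum_exchange (Inr z) = Inl (Inr z)"
  by (simp_all add: sum_exchange_def)

lemma bij_betw_sum_assoc: "bij_betw sum_assoc ((A <+> B) <+> C) (A <+> (B <+> C))"
  by (rule bij_betw_imageI) (force intro: inj_onI simp: image_iff Plus_def image_Un image_image)+

lemma bij_betw_sum_exchange: "bij_betw sum_exchange ((A <+> B) <+> C) ((A <+> C) <+> B)"
  by (rule bij_betw_imageI) (force intro: inj_onI simp: Plus_def image_Un image_image)+

context
  fixes F :: "('u, 'd) forest" and G :: "('v, 'd) forest" and H :: "('w, 'd) forest"
  assumes F: "partitioned_tree F" and G: "partitioned_tree G" and H: "partitioned_tree H"
begin

text \<open>These are the grafts of \<open>H\<close> on the tree \<open>G\<close> that has itself
  been grafted; they make up the product with a nested second factor and cancel in the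
  associator.\<close>

lemma graft_graft_Inr:
  "forest_iso sum_assoc (graft (Inr s') (graft s F G) H) (graft s F (graft s' G H))"
  unfolding forest_iso_def
proof (intro conjI)
  show "bij_betw sum_assoc (verts (graft (Inr s') (graft s F G) H)) (verts (graft s F (graft s' G H)))" by (simp add: bij_betw_sum_assoc)
  show "edges (graft s F (graft s' G H)) = map_prod sum_assoc sum_assoc ` edges (graft (Inr s') (graft s F G) H)"
    unfolding graft_def[of s F "graft s' G H"] roots_graft[OF G H]
  by (simp add: graft_def image_Un image_image map_prod_def case_prod_unfold Un_ac)
  show "parts (graft s F (graft s' G H)) = (`) sum_assoc ` parts (graft (Inr s') (graft s F G) H)"
    by (simp add: image_Un image_image Un_ac)
  show "\<forall>v\<in>verts (graft (Inr s') (graft s F G) H). dec (graft s F (graft s' G H)) (sum_assoc v) = dec (graft (Inr s') (graft s F G) H) v"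
    by auto
qed

text \<open>Two grafts on vertices of \<open>F\<close> commute, even on the same vertex, because
  each grafted tree brings its roots as a part of its own. This is the symmetry of the
  associator.\<close>

lemma graft_graft_Inl:
  "forest_iso sum_exchange (graft (Inl s') (graft s F G) H) (graft (Inl s) (graft s' F H) G)"
  unfolding forest_iso_def
proof (intro conjI)
  show "bij_betw sum_exchange (verts (graft (Inl s') (graft s F G) H)) (verts (graft (Inl s) (graft s' F H) G))" by (simp add: bij_betw_sum_exchange)
  show "edges (graft (Inl s) (graft s' F H) G) = map_prod sum_exchange sum_exchange ` edges (graft (Inl s') (graft s F G) H)"
    by (simp add: graft_def image_Un image_image map_prod_def case_prod_unfold Un_ac)
  show "parts (graft (Inl s) (graft s' F H) G) = (`) sum_exchange ` parts (graft (Inl s') (graft s F G) H)"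
    by (simp add: image_Un image_image Un_ac)
  show "\<forall>v\<in>verts (graft (Inl s') (graft s F G) H). dec (graft (Inl s) (graft s' F H) G) (sum_exchange v) = dec (graft (Inl s') (graft s F G) H) v"
    by auto
qed

text \<open>A graft leaves the roots of \<open>F\<close> as they are, so it makes no difference
  whether their part is merged with that of \<open>G\<close> before or after.\<close>

lemma graft_merge_Inl:
  "forest_iso sum_exchange (graft (Inl s) (merge F G) H) (merge (graft s F H) G)"
proof -
  have p: "parts (graft s F H) - {Inl ` roots F} = (`) Inl ` (parts F - {roots F}) \<union> (`) Inr ` parts H"
  proof -
    have "Inl ` roots F \<noteq> Inr ` p" for p :: "'w set" using partitioned_treeD(7)[OF F] by auto
    then show ?thesis by (auto simp: inj_image_eq_iff)
  qed
  show ?thesis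
    unfolding forest_iso_def
  proof (intro conjI)
    show "bij_betw sum_exchange (verts (graft (Inl s) (merge F G) H)) (verts (merge (graft s F H) G))" by (simp add: bij_betw_sum_exchange)
    show "edges (merge (graft s F H) G) = map_prod sum_exchange sum_exchange ` edges (graft (Inl s) (merge F G) H)"
      by (simp add: graft_def merge_def image_Un image_image map_prod_def case_prod_unfold Un_ac)
    show "parts (merge (graft s F H) G) = (`) sum_exchange ` parts (graft (Inl s) (merge F G) H)"
      unfolding merge_sel(2)[of "graft s F H"] roots_graft[OF F H] p
      by (simp add: image_Un image_image Plus_def Un_ac)
    show "\<forall>v\<in>verts (graft (Inl s) (merge F G) H). dec (merge (graft s F H) G) (sum_exchange v) = dec (graft (Inl s) (merge F G) H) v"
      by auto
  qed
qed

lemma graft_merge_Inr: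
  "forest_iso sum_assoc (graft (Inr s) (merge F G) H) (merge F (graft s G H))"
proof -
  have p: "parts (graft s G H) - {Inl ` roots G} = (`) Inl ` (parts G - {roots G}) \<union> (`) Inr ` parts H"
  proof -
    have "Inl ` roots G \<noteq> Inr ` p" for p :: "'w set" using partitioned_treeD(7)[OF G] by auto
    then show ?thesis by (auto simp: inj_image_eq_iff)
  qed
  show ?thesis
    unfolding forest_iso_def
  proof (intro conjI)
    show "bij_betw sum_assoc (verts (graft (Inr s) (merge F G) H)) (verts (merge F (graft s G H)))" by (simp add: bij_betw_sum_assoc)
    show "edges (merge F (graft s G H)) = map_prod sum_assoc sum_assoc ` edges (graft (Inr s) (merge F G) H)"
      by (simp add: graft_def merge_def image_Un image_image map_prod_def case_prod_unfold Un_ac)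
    show "parts (merge F (graft s G H)) = (`) sum_assoc ` parts (graft (Inr s) (merge F G) H)"
      unfolding merge_sel(2)[of F "graft s G H"] roots_graft[OF G H] p
      by (simp add: image_Un image_image Plus_def Un_ac)
    show "\<forall>v\<in>verts (graft (Inr s) (merge F G) H). dec (merge F (graft s G H)) (sum_assoc v) = dec (graft (Inr s) (merge F G) H) v"
      by auto
  qed
qed

lemma merge_merge:
  "forest_iso sum_assoc (merge (merge F G) H) (merge F (merge G H))"
  unfolding forest_iso_def
proof (intro conjI)
  show "bij_betw sum_assoc (verts (merge (merge F G) H)) (verts (merge F (merge G H)))" by (simp add: bij_betw_sum_assoc)
  show "edges (merge F (merge G H)) = map_prod sum_assoc sum_assoc ` edges (merge (merge F G) H)"
    by (simp add: graft_def merge_def image_Un image_image map_prod_def case_prod_unfold Un_ac)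
  show "parts (merge F (merge G H)) = (`) sum_assoc ` parts (merge (merge F G) H)"
    unfolding merge_sel(2)[of F "merge G H"] merge_sel(2)[of "merge F G" H] roots_merge[OF F G]
      roots_merge[OF G H] parts_merge_minus_roots[OF F G] parts_merge_minus_roots[OF G H]
    by (simp add: image_Un image_image Plus_def Un_ac)
  show "\<forall>v\<in>verts (merge (merge F G) H). dec (merge F (merge G H)) (sum_assoc v) = dec (merge (merge F G) H) v"
    by auto
qed

end

lemma merge_swap: "forest_iso (case_sum Inr Inl) (merge F G) (merge G F)"
  unfolding forest_iso_def
proof (intro conjI)
  show "bij_betw (case_sum Inr Inl) (verts (merge F G)) (verts (merge G F))" by (rule bij_betw_imageI) (auto intro!: inj_onI simp: Plus_def image_Un image_image Un_commute)
  show "edges (merge G F) = map_prod (case_sum Inr Inl) (case_sum Inr Inl) ` edges (merge F G)"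
    by (simp add: graft_def merge_def image_Un image_image map_prod_def case_prod_unfold Un_ac)
  show "parts (merge G F) = (`) (case_sum Inr Inl) ` parts (merge F G)"
    by (simp add: image_Un image_image Plus_def Un_ac)
  show "\<forall>v\<in>verts (merge F G). dec (merge G F) ((case_sum Inr Inl) v) = dec (merge F G) v"
    by auto
qed

section \<open>The Com-Prelie algebra of partitioned trees\<close>

definition lin_ext :: "('k::field \<Rightarrow> 'a::ab_group_add \<Rightarrow> 'a) \<Rightarrow> ('i \<Rightarrow> 'a) \<Rightarrow> ('i \<Rightarrow>\<^sub>0 'k) \<Rightarrow> 'a" where
  "lin_ext scale f x = (\<Sum>t\<in>Poly_Mapping.keys x. scale (Poly_Mapping.lookup x t) (f t))"

lemma lin_ext_0 [simp]: "lin_ext scale f 0 = 0"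
  by (simp add: lin_ext_def)

context vector_space
begin

text \<open>Coefficients may cancel in a sum, so sums over the supports are compared on a common
  finite superset.\<close>

lemma lin_ext_superset:
  assumes "finite S" "Poly_Mapping.keys x \<subseteq> S"
  shows "lin_ext scale f x = (\<Sum>t\<in>S. scale (Poly_Mapping.lookup x t) (f t))"
  unfolding lin_ext_def
  using assms by (intro sum.mono_neutral_left) (auto simp: in_keys_iff)

lemma lin_ext_add: "lin_ext scale f (x + y) = lin_ext scale f x + lin_ext scale f y"
proof -
  let ?S = "Poly_Mapping.keys x \<union> Poly_Mapping.keys y"
  have "finite ?S" "Poly_Mapping.keys (x + y) \<subseteq> ?S"
    by (simp_all add: Poly_Mapping.keys_add)
  then show ?thesis
    by (simp add: lin_ext_superset[of ?S] lookup_add scale_left_distrib sum.distrib)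
qed

lemma lin_ext_scale:
  "lin_ext scale f (Poly_Mapping.map ((*) c) x) = scale c (lin_ext scale f x)"
proof -
  have l: "Poly_Mapping.lookup (Poly_Mapping.map ((*) c) x) t = c * Poly_Mapping.lookup x t" for t
    by (simp add: Poly_Mapping.map.rep_eq when_def)
  then have "Poly_Mapping.keys (Poly_Mapping.map ((*) c) x) \<subseteq> Poly_Mapping.keys x"
    by (auto simp: in_keys_iff)
  then show ?thesis
    by (simp add: lin_ext_superset[OF finite_keys] l) (simp add: lin_ext_def scale_sum_right)
qed

lemma lin_ext_sum: "lin_ext scale f (\<Sum>i\<in>I. x i) = (\<Sum>i\<in>I. lin_ext scale f (x i))"
  by (induction I rule: infinite_finite_induct) (simp_all add: lin_ext_add)

lemma lin_ext_single: "lin_ext scale f (Poly_Mapping.single t c) = scale c (f t)"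
  by (simp add: lin_ext_def)

end

lemma lookup_g_scale [simp]: "Poly_Mapping.lookup (g_scale c x) t = c * Poly_Mapping.lookup x t"
  by (simp add: g_scale_def Poly_Mapping.map.rep_eq when_def)

global_interpretation g: vector_space "g_scale :: 'k::field_char_0 \<Rightarrow> ('b \<Rightarrow>\<^sub>0 'k) \<Rightarrow> ('b \<Rightarrow>\<^sub>0 'k)"
  by standard (auto intro!: poly_mapping_eqI simp: lookup_add algebra_simps)

lemma keys_g_scale: "Poly_Mapping.keys (g_scale c x) \<subseteq> Poly_Mapping.keys x"
  by (auto simp: in_keys_iff)

text \<open>Written as a nested \<open>lin_ext\<close>, the product inherits linearity in each
  argument from the one-variable case.\<close>

lemma bilinear_ext_eq: "bilinear_ext m x y = lin_ext g_scale (\<lambda>t. lin_ext g_scale (m t) y) x"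
  by (simp add: bilinear_ext_def lin_ext_def g.scale_sum_right)

lemma bilinear_ext_single:
  "bilinear_ext m (Poly_Mapping.single t 1) (Poly_Mapping.single u 1) = m t u"
  by (simp add: bilinear_ext_eq g.lin_ext_single)

lemma bilinear_ext_add_left: "bilinear_ext m (x + y) z = bilinear_ext m x z + bilinear_ext m y z"
  by (simp add: bilinear_ext_eq g.lin_ext_add)

lemma bilinear_ext_add_right: "bilinear_ext m z (x + y) = bilinear_ext m z x + bilinear_ext m z y"
  by (simp add: bilinear_ext_eq g.lin_ext_add)
    (simp add: lin_ext_def g.scale_right_distrib sum.distrib)

lemma bilinear_ext_0 [simp]: "bilinear_ext m 0 z = 0" "bilinear_ext m z 0 = 0"
  by (simp_all add: bilinear_ext_def)

lemma bilinear_ext_sum_left: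
  "bilinear_ext m (\<Sum>i\<in>I. x i) z = (\<Sum>i\<in>I. bilinear_ext m (x i) z)"
  by (induction I rule: infinite_finite_induct) (simp_all add: bilinear_ext_add_left)

lemma bilinear_ext_sum_right:
  "bilinear_ext m z (\<Sum>i\<in>I. x i) = (\<Sum>i\<in>I. bilinear_ext m z (x i))"
  by (induction I rule: infinite_finite_induct) (simp_all add: bilinear_ext_add_right)

lemma bilinear_ext_scale_left: "bilinear_ext m (g_scale c x) y = g_scale c (bilinear_ext m x y)"
  by (simp add: bilinear_ext_eq g.lin_ext_scale[folded g_scale_def])

lemma bilinear_ext_scale_right: "bilinear_ext m x (g_scale c y) = g_scale c (bilinear_ext m x y)"
  by (simp add: bilinear_ext_eq g.lin_ext_scale[folded g_scale_def])
    (simp add: lin_ext_def g.scale_sum_right mult.left_commute)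

lemmas g_pre_lin = bilinear_ext_add_left[of pt_pre, folded g_pre_def]
  bilinear_ext_add_right[of pt_pre, folded g_pre_def]
  bilinear_ext_scale_left[of pt_pre, folded g_pre_def]
  bilinear_ext_scale_right[of pt_pre, folded g_pre_def]
  bilinear_ext_sum_left[of pt_pre, folded g_pre_def]
  bilinear_ext_sum_right[of pt_pre, folded g_pre_def]
  bilinear_ext_0[of pt_pre, folded g_pre_def]

lemmas g_sh_lin = bilinear_ext_add_left[of "\<lambda>t u. Poly_Mapping.single (pt_sh t u) 1", folded g_sh_def]
  bilinear_ext_add_right[of "\<lambda>t u. Poly_Mapping.single (pt_sh t u) 1", folded g_sh_def]
  bilinear_ext_scale_left[of "\<lambda>t u. Poly_Mapping.single (pt_sh t u) 1", folded g_sh_def]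
  bilinear_ext_scale_right[of "\<lambda>t u. Poly_Mapping.single (pt_sh t u) 1", folded g_sh_def]
  bilinear_ext_sum_left[of "\<lambda>t u. Poly_Mapping.single (pt_sh t u) 1", folded g_sh_def]
  bilinear_ext_sum_right[of "\<lambda>t u. Poly_Mapping.single (pt_sh t u) 1", folded g_sh_def]
  bilinear_ext_0[of "\<lambda>t u. Poly_Mapping.single (pt_sh t u) 1", folded g_sh_def]

section \<open>Trees as basis vectors, and the axioms checked on them\<close>

definition basis :: "('v, 'd) forest \<Rightarrow> ((nat, 'd) forest set \<Rightarrow>\<^sub>0 'k::field_char_0)" where
  "basis F = Poly_Mapping.single (isoclass F) 1"

lemma basis_iso: "forest_iso f F G \<Longrightarrow> partitioned_tree F \<Longrightarrow> basis F = basis G"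
  by (simp add: basis_def isoclass_eqI)

lemma basis_rep: "t \<in> PT D \<Longrightarrow> Poly_Mapping.single t 1 = basis (rep t)"
  by (simp add: basis_def rep_PT(3))

lemma g_pre_basis:
  "partitioned_tree F \<Longrightarrow> partitioned_tree G \<Longrightarrow> g_pre (basis F) (basis G) = (\<Sum>s\<in>verts F. basis (graft s F G))"
  by (simp add: basis_def g_pre_def bilinear_ext_single pt_pre_isoclass)

lemma g_sh_basis:
  "partitioned_tree F \<Longrightarrow> partitioned_tree G \<Longrightarrow> g_sh (basis F) (basis G) = basis (merge F G)"
  by (simp add: basis_def g_sh_def bilinear_ext_single pt_sh_isoclass)

lemma subspace_gPT: "g.subspace (gPT D)"
  unfolding g.subspace_def gPT_def
  using Poly_Mapping.keys_add keys_g_scale by fastforce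

lemma basis_in_gPT:
  "partitioned_tree F \<Longrightarrow> dec F ` verts F \<subseteq> D \<Longrightarrow> basis F \<in> gPT D"
  by (simp add: basis_def gPT_def isoclass_in_PT)

text \<open>The basis case speaks of trees instead of classes, so that a multilinear identity
  reduces to isomorphisms between grafts and merges.\<close>

lemma gPT_induct [consumes 1, case_names basis zero add scale]:
  fixes x :: "(nat, 'd) forest set \<Rightarrow>\<^sub>0 'k::field_char_0"
  assumes x: "x \<in> gPT D"
    and basis: "\<And>F :: (nat, 'd) forest. partitioned_tree F \<Longrightarrow> dec F ` verts F \<subseteq> D \<Longrightarrow> P (basis F)"
    and zero: "P 0"
    and add: "\<And>x y. x \<in> gPT D \<Longrightarrow> y \<in> gPT D \<Longrightarrow> P x \<Longrightarrow> P y \<Longrightarrow> P (x + y)"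
    and scale: "\<And>c x. x \<in> gPT D \<Longrightarrow> P x \<Longrightarrow> P (g_scale c x)"
  shows "P x"
proof -
  have single: "Poly_Mapping.single t c = g_scale c (Poly_Mapping.single t 1)" for t and c :: 'k
    by (rule poly_mapping_eqI) (simp add: lookup_single when_def)
  have "x = (\<Sum>t\<in>Poly_Mapping.keys x. g_scale (Poly_Mapping.lookup x t) (Poly_Mapping.single t 1))"
    by (rule poly_mapping_eqI)
      (auto simp: lookup_sum lookup_single when_def in_keys_iff sum.If_cases if_distrib cong: if_cong)
  \<comment> \<open>Membership in \<open>gPT D\<close> is carried along, because the cases
    \<open>add\<close> and \<open>scale\<close> ask for it.\<close>
  moreover have "(\<Sum>t\<in>S. g_scale (Poly_Mapping.lookup x t) (Poly_Mapping.single t 1)) \<in> gPT D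
      \<and> P (\<Sum>t\<in>S. g_scale (Poly_Mapping.lookup x t) (Poly_Mapping.single t 1))"
    if "finite S" "S \<subseteq> PT D" for S
    using that
  proof (induction S rule: finite_induct)
    case empty
    then show ?case using zero g.subspace_0[OF subspace_gPT] by simp
  next
    case (insert t S)
    then have t: "t \<in> PT D" by simp
    then have "Poly_Mapping.single t (1::'k) \<in> gPT D" "P (Poly_Mapping.single t 1)"
      using basis[OF rep_PT(1,2)[OF t]] rep_PT(1,2)[OF t] by (simp_all add: basis_rep basis_in_gPT)
    moreover have "(\<Sum>t\<in>S. g_scale (Poly_Mapping.lookup x t) (Poly_Mapping.single t 1)) \<in> gPT D"
      "P (\<Sum>t\<in>S. g_scale (Poly_Mapping.lookup x t) (Poly_Mapping.single t 1))"
      using insert by auto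
    ultimately show ?case
      unfolding sum.insert[OF insert.hyps]
      by (intro conjI add scale g.subspace_add[OF subspace_gPT] g.subspace_scale[OF subspace_gPT])
  qed
  ultimately show ?thesis using x by (metis (no_types, lifting) finite_keys gPT_def mem_Collect_eq)
qed

text \<open>The terms that graft \<open>H\<close> on a vertex of \<open>G\<close> cancel by
  \<open>graft_graft_Inr\<close>; the associator keeps the ordered pairs of vertices of
  \<open>F\<close>, an index set in which \<open>G\<close> and \<open>H\<close> play the same
  role.\<close>

lemma prelie_basis:
  assumes F: "partitioned_tree F" and G: "partitioned_tree G" and H: "partitioned_tree H"
  shows "g_pre (g_pre (basis F) (basis G)) (basis H :: _ \<Rightarrow>\<^sub>0 'k::field_char_0) - g_pre (basis F) (g_pre (basis G) (basis H))
    = (\<Sum>s\<in>verts F. \<Sum>s'\<in>verts F. basis (graft (Inl s') (graft s F G) H))"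
proof -
  have fin: "finite (verts F)" "finite (verts G)" using F G by (simp_all add: partitioned_treeD)
  have "g_pre (g_pre (basis F) (basis G)) (basis H :: _ \<Rightarrow>\<^sub>0 'k)
      = (\<Sum>s\<in>verts F. \<Sum>s'\<in>verts F <+> verts G. basis (graft s' (graft s F G) H))"
    using assms by (simp add: g_pre_basis g_pre_lin partitioned_tree_graft)
  also have "\<dots> = (\<Sum>s\<in>verts F. \<Sum>s'\<in>verts F. basis (graft (Inl s') (graft s F G) H))
      + (\<Sum>s\<in>verts F. \<Sum>s'\<in>verts G. basis (graft (Inr s') (graft s F G) H))"
    by (simp add: sum.Plus[OF fin] sum.distrib)
  also have "(\<Sum>s\<in>verts F. \<Sum>s'\<in>verts G. basis (graft (Inr s') (graft s F G) H))
      = (\<Sum>s\<in>verts F. \<Sum>s'\<in>verts G. basis (graft s F (graft s' G H)))"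
    using assms
    by (intro sum.cong refl basis_iso[OF graft_graft_Inr] partitioned_tree_graft) auto
  also have "\<dots> = g_pre (basis F) (g_pre (basis G) (basis H))"
    using assms by (simp add: g_pre_basis g_pre_lin partitioned_tree_graft sum.swap[of _ "verts F"])
  finally show ?thesis by simp
qed

text \<open>Every vertex of a merge comes from exactly one of the two trees, and a graft on it
  leaves the roots of that tree in place.\<close>

lemma leibniz_basis:
  assumes F: "partitioned_tree F" and G: "partitioned_tree G" and H: "partitioned_tree H"
  shows "g_pre (g_sh (basis F) (basis G)) (basis H)
    = g_sh (g_pre (basis F) (basis H)) (basis G) + g_sh (basis F) (g_pre (basis G) (basis H))"
proof -
  have fin: "finite (verts F)" "finite (verts G)" using F G by (simp_all add: partitioned_treeD)
  have "g_pre (g_sh (basis F) (basis G)) (basis H)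
     = (\<Sum>s\<in>verts F. basis (graft (Inl s) (merge F G) H)) + (\<Sum>s\<in>verts G. basis (graft (Inr s) (merge F G) H))"
    using assms by (simp add: g_sh_basis g_pre_basis partitioned_tree_merge sum.Plus[OF fin])
  also have "(\<Sum>s\<in>verts F. basis (graft (Inl s) (merge F G) H)) = (\<Sum>s\<in>verts F. basis (merge (graft s F H) G))"
    using assms
    by (intro sum.cong refl basis_iso[OF graft_merge_Inl] partitioned_tree_graft partitioned_tree_merge) auto
  also have "(\<Sum>s\<in>verts G. basis (graft (Inr s) (merge F G) H)) = (\<Sum>s\<in>verts G. basis (merge F (graft s G H)))"
    using assms
    by (intro sum.cong refl basis_iso[OF graft_merge_Inr] partitioned_tree_graft partitioned_tree_merge) auto
  finally show ?thesis
    using assms by (simp add: g_sh_basis g_pre_basis g_sh_lin partitioned_tree_graft)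
qed

lemma g_closed:
  assumes "x \<in> gPT D" "y \<in> gPT D"
  shows "g_pre x y \<in> gPT D" "g_sh x y \<in> gPT D"
proof -
  note sub = g.subspace_0[OF subspace_gPT] g.subspace_add[OF subspace_gPT] g.subspace_scale[OF subspace_gPT]
    g.subspace_sum[OF subspace_gPT]
  show "g_pre x y \<in> gPT D" using assms
  proof (induction x rule: gPT_induct)
    case (basis F)
    from basis(3,1,2) show ?case
    proof (induction y rule: gPT_induct)
      case G: (basis G)
      then show ?case unfolding g_pre_basis[OF G(3) G(1)]
        by (intro sub basis_in_gPT partitioned_tree_graft) (simp_all only: dec_graft, auto)
    qed (simp_all add: g_pre_lin sub)
  qed (simp_all add: g_pre_lin sub)
  show "g_sh x y \<in> gPT D" using assms
  proof (induction x rule: gPT_induct)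
    case (basis F)
    from basis(3,1,2) show ?case
    proof (induction y rule: gPT_induct)
      case G: (basis G)
      then show ?case unfolding g_sh_basis[OF G(3) G(1)]
        by (intro sub basis_in_gPT partitioned_tree_merge) (simp_all only: dec_merge, auto)
    qed (simp_all add: g_sh_lin sub)
  qed (simp_all add: g_sh_lin sub)
qed

lemma com_prelie_gPT:
  fixes D :: "'d set"
  shows "com_prelie (g_scale :: 'k::field_char_0 \<Rightarrow> _) (gPT D) g_pre g_sh"
proof (standard, rule subspace_gPT)
  fix x y z :: "(nat, 'd) forest set \<Rightarrow>\<^sub>0 'k"
  assume x: "x \<in> gPT D" and y: "y \<in> gPT D"
  show "g_pre x y \<in> gPT D" "g_sh x y \<in> gPT D" using x y by (simp_all add: g_closed)
  show "g_sh x y = g_sh y x"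
    using x
  proof (induction x rule: gPT_induct)
    case F: (basis F)
    show ?case using y
    proof (induction y rule: gPT_induct)
      case G: (basis G)
      show ?case using F G basis_iso[OF merge_swap, of F G]
        by (simp add: g_sh_basis partitioned_tree_merge)
    qed (simp_all add: g_sh_lin)
  qed (simp_all add: g_sh_lin)
  assume z: "z \<in> gPT D"
  show "g_pre (g_pre x y) z - g_pre x (g_pre y z) = g_pre (g_pre x z) y - g_pre x (g_pre z y)"
    using x
  proof (induction x rule: gPT_induct)
    case F: (basis F)
    show ?case using y
    proof (induction y rule: gPT_induct)
      case G: (basis G)
      show ?case using z
      proof (induction z rule: gPT_induct)
        case H: (basis H)
        \<comment> \<open>\<open>graft_graft_Inl\<close> exchanges \<open>G\<close> and
          \<open>H\<close> together with their vertices \<open>s\<close> and \<open>s'\<close>; the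
          summation runs over all ordered pairs, including \<open>s = s'\<close>.\<close>
        have "(\<Sum>s\<in>verts F. \<Sum>s'\<in>verts F. basis (graft (Inl s') (graft s F G) H))
          = (\<Sum>s\<in>verts F. \<Sum>s'\<in>verts F. basis (graft (Inl s) (graft s' F H) G))"
          using F G H by (intro sum.cong refl basis_iso[OF graft_graft_Inl] partitioned_tree_graft) auto
        also have "\<dots> = (\<Sum>s'\<in>verts F. \<Sum>s\<in>verts F. basis (graft (Inl s) (graft s' F H) G))"
          by (rule sum.swap)
        finally show ?case using F G H by (simp add: prelie_basis)
      qed (simp_all add: g_pre_lin add_diff_add g.scale_right_diff_distrib[symmetric])
    qed (simp_all add: g_pre_lin add_diff_add g.scale_right_diff_distrib[symmetric])
  qed (simp_all add: g_pre_lin add_diff_add g.scale_right_diff_distrib[symmetric])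
  show "g_sh (g_sh x y) z = g_sh x (g_sh y z)"
    using x
  proof (induction x rule: gPT_induct)
    case F: (basis F)
    show ?case using y
    proof (induction y rule: gPT_induct)
      case G: (basis G)
      show ?case using z
      proof (induction z rule: gPT_induct)
        case H: (basis H)
        show ?case using F G H basis_iso[OF merge_merge, of F G H]
          by (simp add: g_sh_basis partitioned_tree_merge)
      qed (simp_all add: g_sh_lin)
    qed (simp_all add: g_sh_lin)
  qed (simp_all add: g_sh_lin)
  show "g_pre (g_sh x y) z = g_sh (g_pre x z) y + g_sh x (g_pre y z)"
    using x
  proof (induction x rule: gPT_induct)
    case F: (basis F)
    show ?case using y
    proof (induction y rule: gPT_induct)
      case G: (basis G)
      show ?case using z
      proof (induction z rule: gPT_induct)
        case H: (basis H)
        show ?case using F G H by (simp add: leibniz_basis)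
      qed (simp_all add: g_sh_lin g_pre_lin g.scale_right_distrib add_ac)
    qed (simp_all add: g_sh_lin g_pre_lin g.scale_right_distrib add_ac)
  qed (simp_all add: g_sh_lin g_pre_lin g.scale_right_distrib add_ac)
qed (simp_all add: g_pre_lin g_sh_lin)

section \<open>Symmetric braces\<close>

text \<open>With the whole type as carrier, the braces can be formed without membership conditions;
  the general target is reduced to this case in \<open>total_extension\<close>.\<close>

locale total_com_prelie = com_prelie scale UNIV pre sh
  for scale :: "'k::field_char_0 \<Rightarrow> 'a::ab_group_add \<Rightarrow> 'a" and pre sh
begin

section \<open>Finite commutative products in the target\<close>

lemma pre_0_left [simp]: "pre 0 z = 0"
  using pre_add_left[of 0 0 z] by simp

lemma pre_0_right [simp]: "pre z 0 = 0"
  using pre_add_right[of z 0 0] by simp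

lemma sh_0_left [simp]: "sh 0 z = 0"
  using sh_add_left[of 0 0 z] by simp

lemma pre_sum_left: "pre (\<Sum>i\<in>I. f i) z = (\<Sum>i\<in>I. pre (f i) z)"
  by (induction I rule: infinite_finite_induct) (simp_all add: pre_add_left)

lemma sh_sum_left: "sh (\<Sum>i\<in>I. f i) z = (\<Sum>i\<in>I. sh (f i) z)"
  by (induction I rule: infinite_finite_induct) (simp_all add: sh_add_left)

lemma pre_diff_left: "pre (x - y) z = pre x z - pre y z"
  using pre_add_left[of "x - y" y z] by (simp add: eq_diff_eq)

text \<open>\<open>None\<close> adjoins a unit, which \<open>sh\<close> need not have, so that the
  finite products of \<open>comm_monoid_set\<close> become available.\<close>

definition osh :: "'a option \<Rightarrow> 'a option \<Rightarrow> 'a option" where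
  "osh x y = (case x of None \<Rightarrow> y | Some u \<Rightarrow> (case y of None \<Rightarrow> x | Some v \<Rightarrow> Some (sh u v)))"

sublocale oprod: comm_monoid_set osh None
  by standard (auto simp: osh_def sh_assoc intro: sh_commute split: option.splits)

context
  notes fun_upd_apply [simp del] fun_upd_same [simp] fun_upd_other [simp]
begin

text \<open>Meaningful for finite nonempty \<open>S\<close>; on the empty set the value is
  \<open>the None\<close>.\<close>

definition shprod :: "('i \<Rightarrow> 'a) \<Rightarrow> 'i set \<Rightarrow> 'a" where
  "shprod f S = the (oprod.F (\<lambda>i. Some (f i)) S)"

lemma oprod_Some:
  assumes "finite S" "S \<noteq> {}"
  shows "oprod.F (\<lambda>i. Some (f i)) S = Some (shprod f S)"
proof -
  have "oprod.F (\<lambda>i. Some (f i)) S \<noteq> None"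
    using assms by (induction S rule: finite_ne_induct) (auto simp: osh_def)
  then show ?thesis by (auto simp: shprod_def)
qed

lemma shprod_singleton [simp]: "shprod f {i} = f i"
  by (simp add: shprod_def osh_def)

lemma shprod_union:
  assumes "finite S" "finite T" "S \<noteq> {}" "T \<noteq> {}" "S \<inter> T = {}"
  shows "shprod f (S \<union> T) = sh (shprod f S) (shprod f T)"
  using assms oprod.union_disjoint[of S T "\<lambda>i. Some (f i)"]
  by (simp add: oprod_Some osh_def)

lemma shprod_insert:
  assumes "finite S" "S \<noteq> {}" "i \<notin> S"
  shows "shprod f (insert i S) = sh (f i) (shprod f S)"
  using shprod_union[of "{i}" S f] assms by simp

lemma shprod_cong: "(\<And>i. i \<in> S \<Longrightarrow> f i = g i) \<Longrightarrow> shprod f S = shprod g S"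
  by (simp add: shprod_def cong: oprod.cong)

lemma shprod_reindex: "inj_on h S \<Longrightarrow> shprod f (h ` S) = shprod (f \<circ> h) S"
  by (simp add: shprod_def oprod.reindex o_def)

text \<open>Isolates the factor at \<open>r\<close>. The case \<open>S = {r}\<close> stands apart
  because no meaning is attached to the empty product.\<close>

lemma shprod_fun_upd:
  assumes "finite S" "r \<in> S"
  shows "shprod (f(r := x)) S = (if S = {r} then x else sh x (shprod f (S - {r})))"
proof (cases "S = {r}")
  case False
  with assms have "S - {r} \<noteq> {}" by blast
  then have "shprod (f(r := x)) (insert r (S - {r})) = sh x (shprod (f(r := x)) (S - {r}))"
    using assms by (subst shprod_insert) auto
  also have "shprod (f(r := x)) (S - {r}) = shprod f (S - {r})"
    by (rule shprod_cong) auto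
  finally show ?thesis using False assms by (simp add: insert_absorb)
qed simp

lemma shprod_upd_sum:
  assumes "finite S" "r \<in> S"
  shows "shprod (f(r := \<Sum>i\<in>I. g i)) S = (\<Sum>i\<in>I. shprod (f(r := g i)) S)"
  using assms by (simp add: shprod_fun_upd sh_sum_left)

text \<open>By the Leibniz rule, right multiplication by \<open>c\<close> is a derivation of
  \<open>sh\<close>, so it acts on one factor at a time.\<close>

lemma pre_shprod:
  assumes "finite S" "S \<noteq> {}"
  shows "pre (shprod f S) c = (\<Sum>r\<in>S. shprod (f(r := pre (f r) c)) S)"
  using assms
proof (induction S rule: finite_ne_induct)
  case (insert i S)
  have "pre (shprod f (insert i S)) c
      = sh (pre (f i) c) (shprod f S) + (\<Sum>r\<in>S. sh (f i) (shprod (f(r := pre (f r) c)) S))"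
    using insert by (simp add: shprod_insert leibniz sh_commute[of "f i"] sh_sum_left sh_commute[of _ "pre (f i) c"])
  moreover have "shprod (f(i := pre (f i) c)) (insert i S) = sh (pre (f i) c) (shprod f S)"
    using insert by (auto simp: shprod_fun_upd)
  moreover have "shprod (f(r := pre (f r) c)) (insert i S) = sh (f i) (shprod (f(r := pre (f r) c)) S)"
    if "r \<in> S" for r
    using insert that by (auto simp: shprod_insert fun_upd_apply)
  ultimately show ?case using insert by simp
qed simp

text \<open>The symmetric braces of Oudom and Guin, for a family of arguments \<open>f\<close> indexed by
  a list of distinct indices.\<close>

primrec lbrace :: "'a \<Rightarrow> 'i list \<Rightarrow> ('i \<Rightarrow> 'a) \<Rightarrow> 'a" where
  "lbrace x [] f = x"
| "lbrace x (i # is) f = pre (lbrace x is f) (f i)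
     - (\<Sum>j\<in>set is. lbrace x is (f(j := pre (f j) (f i))))"

section \<open>Additivity and symmetry of the braces\<close>

lemma lbrace_cong: "(\<And>i. i \<in> set is \<Longrightarrow> f i = g i) \<Longrightarrow> lbrace x is f = lbrace x is g"
proof (induction "is" arbitrary: f g)
  case (Cons i "is")
  have "lbrace x is (f(j := pre (f j) (f i))) = lbrace x is (g(j := pre (g j) (g i)))"
    if "j \<in> set is" for j
    using Cons.prems that by (intro Cons.IH) (auto simp: fun_upd_apply)
  moreover have "lbrace x is f = lbrace x is g" using Cons.prems by (intro Cons.IH) auto
  ultimately show ?case using Cons.prems by simp
qed simp

text \<open>The induction generalizes the index and both summands: when \<open>j\<close> is the head
  of the list, the recursion multiplies the other arguments by \<open>y + z\<close> and so moves the
  sum into their places.\<close>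

lemma lbrace_upd_add:
  assumes "distinct is" "j \<in> set is"
  shows "lbrace x is (f(j := y + z)) = lbrace x is (f(j := y)) + lbrace x is (f(j := z))"
  using assms
proof (induction "is" arbitrary: f j y z)
  case (Cons i "is")
  have ij: "lbrace x is (f(i := w)) = lbrace x is f" for w f
    using Cons.prems by (intro lbrace_cong) (auto simp: fun_upd_apply)
  show ?case
  proof (cases "j = i")
    case True
    have "lbrace x is (f(i := w, l := u)) = lbrace x is (f(l := u))"
      if "l \<in> set is" for l w u
      using Cons.prems that by (intro lbrace_cong) (auto simp: fun_upd_apply)
    moreover have "l \<noteq> i" if "l \<in> set is" for l using Cons.prems that by auto
    ultimately show ?thesis
      using Cons True by (simp add: ij pre_add_right sum.distrib)
  next
    case False
    with Cons.prems have j: "j \<in> set is" and d: "distinct is" by auto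
    \<comment> \<open>For \<open>l = j\<close> the new value itself is multiplied by
      \<open>f i\<close>; otherwise the updates at the two indices commute.\<close>
    have "lbrace x is ((f(j := w))(l := pre ((f(j := w)) l) (f i)))
        = (if l = j then lbrace x is (f(j := pre w (f i)))
           else lbrace x is ((f(l := pre (f l) (f i)))(j := w)))" for l w
      by (simp add: fun_upd_twist)
    then have "lbrace x is ((f(j := y + z))(l := pre ((f(j := y + z)) l) (f i)))
        = lbrace x is ((f(j := y))(l := pre ((f(j := y)) l) (f i)))
        + lbrace x is ((f(j := z))(l := pre ((f(j := z)) l) (f i)))" for l
      using Cons.IH[OF d j] by (simp add: pre_add_left)
    then show ?thesis
      using False Cons.IH[OF d j] by (simp add: pre_add_left sum.distrib)
  qed
qed simp

text \<open>The prelie identity without subtraction, as it is met when two new arguments both act on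
  the same older argument \<open>y\<close>.\<close>

lemma prelie_sym: "pre (pre y u) w + pre y (pre w u) = pre (pre y w) u + pre y (pre u w)"
  using prelie[of y u w] by (simp add: algebra_simps)

text \<open>Both recursion steps are expanded, and each group of terms is symmetric in
  \<open>i\<close> and \<open>k\<close>. The associator of \<open>B f\<close>, \<open>f k\<close>,
  \<open>f i\<close> is so by \<open>prelie\<close>; the terms where both act on one argument
  \<open>j\<close> are so by \<open>prelie_sym\<close>; those where they act on two different
  arguments by renaming (\<open>S_sym\<close>). The two sums where one acts on an argument and the
  other on the whole brace trade places.\<close>

lemma lbrace_swap:
  assumes d: "distinct (i # k # is)"
  shows "lbrace x (i # k # is) f = lbrace x (k # i # is) f"
proof -
  define B where "B = lbrace x is"
  have ni: "i \<notin> set is" "k \<notin> set is" "i \<noteq> k" and di: "distinct is" using d by auto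
  have Bupd: "B (g(l := w)) = B g" if "l \<notin> set is" for g l w
    unfolding B_def using that by (intro lbrace_cong) (auto simp: fun_upd_apply)
  \<comment> \<open>Terms in which the two new arguments act on distinct older ones.\<close>
  define S where "S u w = (\<Sum>j\<in>set is. \<Sum>l\<in>set is - {j}. B (f(j := pre (f j) u, l := pre (f l) w)))" for u w
  have S_sym: "S u w = S w u" for u w
  proof -
    have "S u w = (\<Sum>(j, l) \<in> (SIGMA j:set is. set is - {j}). B (f(j := pre (f j) u, l := pre (f l) w)))"
      unfolding S_def by (rule sum.Sigma) auto
    also have "\<dots> = (\<Sum>(j, l) \<in> (SIGMA j:set is. set is - {j}). B (f(j := pre (f j) w, l := pre (f l) u)))"
      by (rule sum.reindex_bij_witness[where i = prod.swap and j = prod.swap])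
        (auto intro!: arg_cong[of _ _ B] fun_upd_twist)
    also have "\<dots> = S w u"
      unfolding S_def by (rule sum.Sigma[symmetric]) auto
    finally show ?thesis .
  qed
  have expand: "lbrace x (i # k # is) f
     = pre (pre (B f) (f k)) (f i) - pre (B f) (pre (f k) (f i))
       - (\<Sum>j\<in>set is. pre (B (f(j := pre (f j) (f k)))) (f i))
       - (\<Sum>j\<in>set is. pre (B (f(j := pre (f j) (f i)))) (f k))
       + (\<Sum>j\<in>set is. B (f(j := pre (pre (f j) (f i)) (f k) + pre (f j) (pre (f k) (f i)))))
       + S (f i) (f k)"
    if "i \<notin> set is" "k \<notin> set is" "i \<noteq> k" for i k
  proof -
    have 1: "lbrace x (k # is) (f(k := pre (f k) (f i)))
       = pre (B f) (pre (f k) (f i)) - (\<Sum>j\<in>set is. B (f(j := pre (f j) (pre (f k) (f i)))))"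
    proof -
      have "B (f(k := pre (f k) (f i), j := pre (f j) (pre (f k) (f i))))
          = B (f(j := pre (f j) (pre (f k) (f i))))" if "j \<in> set is" for j
        using Bupd[OF \<open>k \<notin> set is\<close>, of "f(j := pre (f j) (pre (f k) (f i)))"] that \<open>k \<notin> set is\<close>
        by (metis fun_upd_twist)
      moreover have "j \<noteq> k" if "j \<in> set is" for j using that \<open>k \<notin> set is\<close> by auto
      ultimately show ?thesis using Bupd[OF \<open>k \<notin> set is\<close>] by (simp add: B_def[symmetric])
    qed
    \<comment> \<open>After \<open>f i\<close> has acted on the argument at \<open>j\<close>,
      \<open>f k\<close> acts on the whole brace, once more on the argument at \<open>j\<close>, or
      on another one at \<open>l\<close>.\<close>
    have 2: "lbrace x (k # is) (f(j := pre (f j) (f i)))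
       = pre (B (f(j := pre (f j) (f i)))) (f k) - B (f(j := pre (pre (f j) (f i)) (f k)))
         - (\<Sum>l\<in>set is - {j}. B (f(j := pre (f j) (f i), l := pre (f l) (f k))))"
      if j: "j \<in> set is" for j
    proof -
      have jk: "k \<noteq> j" using j \<open>k \<notin> set is\<close> by auto
      have "(\<Sum>l\<in>set is. B (f(j := pre (f j) (f i), l := pre ((f(j := pre (f j) (f i))) l) (f k))))
         = B (f(j := pre (pre (f j) (f i)) (f k)))
         + (\<Sum>l\<in>set is - {j}. B (f(j := pre (f j) (f i), l := pre ((f(j := pre (f j) (f i))) l) (f k))))"
        using j by (subst sum.remove[of _ j]) auto
      also have "(\<Sum>l\<in>set is - {j}. B (f(j := pre (f j) (f i), l := pre ((f(j := pre (f j) (f i))) l) (f k))))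
         = (\<Sum>l\<in>set is - {j}. B (f(j := pre (f j) (f i), l := pre (f l) (f k))))"
        by (rule sum.cong) auto
      finally show ?thesis using jk by (simp add: B_def[symmetric])
    qed
    have "lbrace x (i # k # is) f = pre (lbrace x (k # is) f) (f i)
       - (lbrace x (k # is) (f(k := pre (f k) (f i)))
          + (\<Sum>j\<in>set is. lbrace x (k # is) (f(j := pre (f j) (f i)))))"
      using that by (simp del: lbrace.simps(2) add: lbrace.simps(2)[of x i "k # is"])
    also have "pre (lbrace x (k # is) f) (f i)
       = pre (pre (B f) (f k)) (f i) - (\<Sum>j\<in>set is. pre (B (f(j := pre (f j) (f k)))) (f i))"
      by (simp add: B_def[symmetric] pre_diff_left pre_sum_left)
    also have "(\<Sum>j\<in>set is. lbrace x (k # is) (f(j := pre (f j) (f i))))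
       = (\<Sum>j\<in>set is. pre (B (f(j := pre (f j) (f i)))) (f k))
         - (\<Sum>j\<in>set is. B (f(j := pre (pre (f j) (f i)) (f k)))) - S (f i) (f k)"
      unfolding S_def sum_subtractf[symmetric] by (rule sum.cong) (simp_all only: 2)
    finally show ?thesis
      unfolding 1 B_def using di
      by (simp add: lbrace_upd_add sum.distrib algebra_simps)
  qed
  show ?thesis
    unfolding expand[OF ni] expand[OF ni(2,1) ni(3)[symmetric]]
    using prelie[of "B f" "f k" "f i"] S_sym[of "f i" "f k"]
    by (simp add: prelie_sym[of _ "f i" "f k"])
qed

text \<open>Exchanging the two outermost arguments suffices. If the heads \<open>i\<close> and
  \<open>k\<close> differ, the induction hypothesis for the tail moves \<open>k\<close> directly
  behind \<open>i\<close>, \<open>lbrace_swap\<close> brings it to the front, and the tails behind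
  \<open>k\<close> agree by induction again.\<close>

lemma lbrace_perm:
  fixes xs ys :: "'i list"
  assumes "distinct xs" "distinct ys" "set xs = set ys"
  shows "lbrace x xs f = lbrace x ys f"
  using assms
proof (induction "length xs" arbitrary: xs ys f rule: less_induct)
  case less
  show ?case
  proof (cases xs)
    case Nil
    then show ?thesis using less.prems by simp
  next
    case (Cons i "is")
    show ?thesis
    proof (cases ys)
      case Nil
      then show ?thesis using less.prems Cons by simp
    next
      case ys: (Cons k ks)
      have tails: "lbrace x (l # us) g = lbrace x (l # vs) g"
        if "length us < length xs" "distinct us" "distinct vs" "set us = set vs" for l :: 'i and us vs g
        using less.hyps[OF that] that(4) by simp
      show ?thesis
      proof (cases "k = i")
        case True
        then show ?thesis
          using less.prems Cons ys by (auto intro!: tails simp del: lbrace.simps)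
      next
        case False
        define us where "us = removeAll k is"
        have us: "distinct us" "set us = set is - {k}" using less.prems Cons
          by (auto simp: us_def distinct_removeAll)
        have k: "k \<in> set is" using less.prems Cons ys False by auto
        have len: "length us < length is" using k unfolding us_def by (rule length_removeAll_less)
        have "lbrace x xs f = lbrace x (i # k # us) f"
          unfolding Cons using less.prems Cons us k by (intro tails) auto
        also have "\<dots> = lbrace x (k # i # us) f"
          using less.prems Cons us False by (intro lbrace_swap) auto
        also have "\<dots> = lbrace x ys f"
          unfolding ys using less.prems Cons ys us k len False by (intro tails) auto
        finally show ?thesis .
      qed
    qed
  qed
qed

text \<open>Sets index the arguments because the parts of the children of a vertex have no order; by
  \<open>lbrace_perm\<close> the enumeration chosen is irrelevant.\<close>

definition brace :: "'a \<Rightarrow> 'i set \<Rightarrow> ('i \<Rightarrow> 'a) \<Rightarrow> 'a" where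
  "brace x S = lbrace x (SOME xs. distinct xs \<and> set xs = S)"

lemma brace_eq_lbrace:
  assumes "distinct xs"
  shows "brace x (set xs) f = lbrace x xs f"
proof -
  have "distinct (SOME ys. distinct ys \<and> set ys = set xs)
      \<and> set (SOME ys. distinct ys \<and> set ys = set xs) = set xs"
    by (rule someI[of _ xs]) (use assms in simp)
  then show ?thesis unfolding brace_def using assms by (intro lbrace_perm) auto
qed

lemma brace_empty [simp]: "brace x {} f = x"
  using brace_eq_lbrace[of "[]"] by simp

lemma brace_insert:
  assumes "finite S" "i \<notin> S"
  shows "brace x (insert i S) f
    = pre (brace x S f) (f i) - (\<Sum>j\<in>S. brace x S (f(j := pre (f j) (f i))))"
proof -
  obtain xs where "set xs = S" "distinct xs" using finite_distinct_list[OF assms(1)] by blast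
  then show ?thesis
    using assms brace_eq_lbrace[of "i # xs" x f] brace_eq_lbrace[of xs x] by auto
qed

lemma brace_cong:
  assumes "finite S" "\<And>i. i \<in> S \<Longrightarrow> f i = g i"
  shows "brace x S f = brace x S g"
  using finite_distinct_list[OF assms(1)] assms(2) brace_eq_lbrace
  by (metis lbrace_cong)

lemma brace_upd_sum:
  assumes "finite S" "j \<in> S"
  shows "brace x S (f(j := \<Sum>i\<in>I. g i)) = (\<Sum>i\<in>I. brace x S (f(j := g i)))"
proof -
  obtain xs where xs: "set xs = S" "distinct xs" using finite_distinct_list[OF assms(1)] by blast
  have add: "brace x S (f(j := y + z)) = brace x S (f(j := y)) + brace x S (f(j := z))" for y z
    using lbrace_upd_add[of xs j x f y z] xs assms(2) by (auto simp: brace_eq_lbrace)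
  from this[of 0 0] have "brace x S (f(j := 0)) = 0" by simp
  then show ?thesis by (induction I rule: infinite_finite_induct) (simp_all add: add)
qed

lemma brace_reindex:
  assumes "finite S" "inj_on h S"
  shows "brace x (h ` S) f = brace x S (f \<circ> h)"
  using assms
proof (induction S arbitrary: f rule: finite_induct)
  case (insert i S)
  then have ni: "h i \<notin> h ` S" and inj: "inj_on h S" by auto
  have "brace x (h ` S) (f(h j := y)) = brace x S ((f \<circ> h)(j := y))" if "j \<in> S" for j y
    unfolding insert.IH[OF inj] using insert.hyps that inj
    by (intro brace_cong) (auto simp: fun_upd_apply dest: inj_onD)
  then show ?case
    using insert.hyps ni inj insert.IH[OF inj]
    by (simp add: brace_insert sum.reindex o_def)
qed simp

end

end

section \<open>Evaluation of partitioned trees\<close>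

lemma filter_image_Un: "{x \<in> f ` A \<union> g ` B. P x} = f ` {a \<in> A. P (f a)} \<union> g ` {b \<in> B. P (g b)}"
  by blast

lemma filter_insert_image_Un:
  "\<not> P r \<Longrightarrow> {x \<in> insert r (f ` A \<union> g ` B). P x} = f ` {a \<in> A. P (f a)} \<union> g ` {b \<in> B. P (g b)}"
  by blast

text \<open>In a partitioned tree every part other than \<open>roots F\<close> lies over a single
  vertex, so these are whole parts and they exhaust the children of \<open>v\<close>
  (\<open>Union_blocks\<close>).\<close>

definition blocks :: "('v, 'd) forest \<Rightarrow> 'v \<Rightarrow> 'v set set" where
  "blocks F v = {p \<in> parts F. \<forall>c\<in>p. (c, v) \<in> edges F}"

abbreviation above :: "('v, 'd) forest \<Rightarrow> 'v \<Rightarrow> 'v set" where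
  "above F v \<equiv> {s. (s, v) \<in> (edges F)\<^sup>*}"

context
  fixes F :: "('v, 'd) forest"
  assumes F: "partitioned_tree F"
begin

lemma finite_parts: "finite (parts F)" "p \<in> parts F \<Longrightarrow> finite p" "p \<in> parts F \<Longrightarrow> p \<noteq> {}"
  "p \<in> parts F \<Longrightarrow> p \<subseteq> verts F"
proof -
  note F' = partitioned_treeD[OF F]
  show "finite (parts F)" by (rule finite_elements[OF F'(1,5)])
  show "p \<subseteq> verts F" if "p \<in> parts F" using that partition_onD1[OF F'(5)] by blast
  then show "finite p" if "p \<in> parts F" using that F'(1) finite_subset by blast
  show "p \<noteq> {}" if "p \<in> parts F" using that partition_onD3[OF F'(5)] by blast
qed

lemma finite_blocks: "finite (blocks F v)"
  using finite_parts(1) by (simp add: blocks_def)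

lemma roots_notin_blocks: "roots F \<notin> blocks F v"
  using partitioned_treeD(7)[OF F] by (auto simp: blocks_def roots_def)

lemma Union_blocks: "\<Union>(blocks F v) = {c. (c, v) \<in> edges F}"
proof (intro set_eqI iffI)
  note F' = partitioned_treeD[OF F]
  fix c assume "c \<in> {c. (c, v) \<in> edges F}"
  then have c: "(c, v) \<in> edges F" by simp
  then obtain p where p: "p \<in> parts F" "c \<in> p"
    using F'(2) partition_onD1[OF F'(5)] by blast
  have "p \<noteq> roots F" using c p by (auto simp: roots_def)
  then have "(x, v) \<in> edges F" if "x \<in> p" for x
    using F'(8)[OF p(1) _ p(2) that] c F'(3) by (auto dest: single_valuedD)
  then show "c \<in> \<Union>(blocks F v)" using p by (auto simp: blocks_def)
qed (auto simp: blocks_def)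

lemma finite_above: "v \<in> verts F \<Longrightarrow> above F v \<subseteq> verts F" "v \<in> verts F \<Longrightarrow> finite (above F v)"
proof -
  show "above F v \<subseteq> verts F" if "v \<in> verts F"
  proof
    fix s assume "s \<in> above F v"
    then have "(s, v) \<in> (edges F)\<^sup>*" by simp
    then show "s \<in> verts F"
      using that partitioned_treeD(2)[OF F] by (cases rule: converse_rtranclE) auto
  qed
  then show "finite (above F v)" if "v \<in> verts F"
    using that partitioned_treeD(1)[OF F] finite_subset by blast
qed

text \<open>A path from \<open>r\<close> to a different sibling \<open>r'\<close> would start with
  the only edge out of \<open>r\<close>, to the common vertex \<open>v\<close>, and then lead to
  \<open>r'\<close> and back to \<open>v\<close>: a cycle. From a root no path starts at
  all.\<close>

lemma above_disjoint_aux: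
  assumes "(\<exists>v. (r, v) \<in> edges F \<and> (r', v) \<in> edges F) \<or> r \<in> roots F" "(r, r') \<in> (edges F)\<^sup>*"
  shows "r = r'"
proof (rule ccontr)
  note F' = partitioned_treeD[OF F]
  assume "r \<noteq> r'"
  with assms(2) obtain u where u: "(r, u) \<in> edges F" "(u, r') \<in> (edges F)\<^sup>*"
    by (meson converse_rtranclE)
  then have "r \<notin> roots F" by (auto simp: roots_def)
  then obtain v where v: "(r, v) \<in> edges F" "(r', v) \<in> edges F" using assms(1) by blast
  then have "u = v" using u F'(3) by (auto dest: single_valuedD)
  then have "(v, v) \<in> (edges F)\<^sup>+" using u v by auto
  then show False using wf_acyclic[OF F'(4)] by (auto simp: acyclic_def)
qed

text \<open>Edges are single-valued, so two paths from the same \<open>s\<close> are comparable, and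
  one of \<open>r\<close>, \<open>r'\<close> would lie above the other.\<close>

lemma above_disjoint:
  assumes "(\<exists>v. (r, v) \<in> edges F \<and> (r', v) \<in> edges F) \<or> (r \<in> roots F \<and> r' \<in> roots F)" "r \<noteq> r'"
  shows "above F r \<inter> above F r' = {}"
proof -
  have False if "(s, r) \<in> (edges F)\<^sup>*" "(s, r') \<in> (edges F)\<^sup>*" for s
    using single_valued_confluent[OF partitioned_treeD(3)[OF F] that] above_disjoint_aux[of r r']
      above_disjoint_aux[of r' r] assms by blast
  then show ?thesis by blast
qed

lemma above_disjoint_part:
  assumes "p \<in> parts F" "r \<in> p" "r' \<in> p" "r \<noteq> r'"
  shows "above F r \<inter> above F r' = {}"
  using partitioned_treeD(8)[OF F assms(1) _ assms(2,3)] assms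
  by (intro above_disjoint) auto

lemma above_unfold: "above F v = insert v (\<Union>c\<in>{c. (c, v) \<in> edges F}. above F c)"
proof (intro set_eqI iffI)
  fix s assume "s \<in> above F v"
  then have "(s, v) \<in> (edges F)\<^sup>*" by simp
  then show "s \<in> insert v (\<Union>c\<in>{c. (c, v) \<in> edges F}. above F c)"
    by (cases rule: rtranclE) auto
qed (auto intro: rtrancl_into_rtrancl)

lemma not_above_child: "(c, v) \<in> edges F \<Longrightarrow> (v, c) \<notin> (edges F)\<^sup>*"
  using wf_acyclic[OF partitioned_treeD(4)[OF F]] by (auto simp: acyclic_def dest: rtrancl_into_trancl1)

lemma verts_eq_above_roots: "verts F = (\<Union>r\<in>roots F. above F r)"
proof (intro equalityI subsetI)
  note F' = partitioned_treeD[OF F]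
  have "finite (edges F)" using F'(1,2) by (meson finite_SigmaI finite_subset)
  \<comment> \<open>The induction climbs from the roots, against the order used for values;
    finiteness makes the converse relation well-founded too.\<close>
  then have wf: "wf ((edges F)\<inverse>)" using wf_acyclic[OF F'(4)] by (rule finite_acyclic_wf_converse)
  fix v assume "v \<in> verts F"
  then show "v \<in> (\<Union>r\<in>roots F. above F r)"
  proof (induction v rule: wf_induct_rule[OF wf])
    case (1 v)
    show ?case
    proof (cases "v \<in> roots F")
      case False
      then obtain w where w: "(v, w) \<in> edges F" using 1 by (auto simp: roots_def)
      then have "w \<in> (\<Union>r\<in>roots F. above F r)" using 1 F'(2) by auto
      then show ?thesis using w by (auto intro: converse_rtrancl_into_rtrancl)
    qed auto
  qed
next
  fix v assume "v \<in> (\<Union>r\<in>roots F. above F r)"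
  then show "v \<in> verts F" using finite_above(1) by (auto simp: roots_def)
qed

end

lemma forest_iso_edge:
  assumes "forest_iso f F G" "partitioned_tree F" "x \<in> verts F" "y \<in> verts F"
  shows "(f x, f y) \<in> edges G \<longleftrightarrow> (x, y) \<in> edges F"
proof
  have inj: "inj_on f (verts F)" and e: "edges G = map_prod f f ` edges F"
    using assms(1) by (auto simp: forest_iso_def bij_betw_def)
  assume "(f x, f y) \<in> edges G"
  then obtain x' y' where "(x', y') \<in> edges F" "f x' = f x" "f y' = f y" by (auto simp: e)
  moreover from this have "x' = x" "y' = y"
    using partitioned_treeD(2)[OF assms(2)] assms(3,4) inj by (auto dest: inj_onD)
  ultimately show "(x, y) \<in> edges F" by simp
next
  show "(f x, f y) \<in> edges G" if "(x, y) \<in> edges F"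
    using assms(1) that by (force simp: forest_iso_def)
qed

lemma blocks_iso:
  assumes f: "forest_iso f F G" and F: "partitioned_tree F" and v: "v \<in> verts F"
  shows "blocks G (f v) = (`) f ` blocks F v"
proof -
  have "parts G = (`) f ` parts F" using f by (simp add: forest_iso_def)
  moreover have "(\<forall>c\<in>f ` p. (c, f v) \<in> edges G) \<longleftrightarrow> (\<forall>c\<in>p. (c, v) \<in> edges F)" if "p \<in> parts F" for p
    using forest_iso_edge[OF f F _ v] finite_parts(4)[OF F that] by auto
  ultimately show ?thesis unfolding blocks_def by auto
qed

context
  fixes F :: "('v, 'd) forest" and G :: "('w, 'd) forest"
  assumes F: "partitioned_tree F" and G: "partitioned_tree G"
begin

lemma blocks_merge:
  "blocks (merge F G) (Inl v) = (`) Inl ` blocks F v"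
  "blocks (merge F G) (Inr w) = (`) Inr ` blocks G w"
proof -
  \<comment> \<open>The merged root part meets both summands, whereas the edges of a merge stay
    within one, so this part hangs on no vertex.\<close>
  have root: "\<not> (\<forall>c\<in>roots F <+> roots G. (c, x) \<in> edges (merge F G))" for x
  proof -
    obtain f g where fg: "Inl f \<in> roots F <+> roots G" "Inr g \<in> roots F <+> roots G"
      using partitioned_treeD(7)[OF F] partitioned_treeD(7)[OF G] by blast
    show ?thesis
    proof (cases x)
      case (Inl a)
      then have "(Inr g, x) \<notin> edges (merge F G)" by simp
      then show ?thesis using fg by blast
    next
      case (Inr b)
      then have "(Inl f, x) \<notin> edges (merge F G)" by simp
      then show ?thesis using fg by blast
    qed
  qed
  show "blocks (merge F G) (Inl v) = (`) Inl ` blocks F v"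
    unfolding blocks_def[of "merge F G"] merge_sel
      filter_insert_image_Un[where P = "\<lambda>p. \<forall>c\<in>p. (c, Inl v) \<in> edges (merge F G)", OF root]
    using finite_parts(3)[OF G] roots_notin_blocks[OF F, of v] by (auto simp: blocks_def)
  show "blocks (merge F G) (Inr w) = (`) Inr ` blocks G w"
    unfolding blocks_def[of "merge F G"] merge_sel
      filter_insert_image_Un[where P = "\<lambda>p. \<forall>c\<in>p. (c, Inr w) \<in> edges (merge F G)", OF root]
    using finite_parts(3)[OF F] roots_notin_blocks[OF G, of w] by (auto simp: blocks_def)
qed

text \<open>\<open>roots G\<close> is the only part of \<open>G\<close> consisting of roots, so
  \<open>s\<close> gains exactly one part of children. That it stays separate from the old ones is
  why a graft on \<open>s\<close> inserts one argument into the brace at \<open>s\<close>.\<close>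

lemma blocks_graft:
  "blocks (graft s F G) (Inl v) = (if v = s then insert (Inr ` roots G) else id) ((`) Inl ` blocks F v)"
  "blocks (graft s F G) (Inr w) = (`) Inr ` blocks G w"
proof -
  have "(\<forall>c\<in>q. c \<in> roots G \<and> v = s) \<longleftrightarrow> v = s \<and> q = roots G" if "q \<in> parts G" for q
    using partition_on_eq[OF partitioned_treeD(5)[OF G] that partitioned_treeD(6)[OF G]]
      finite_parts(3)[OF G that] by blast
  then have "{q \<in> parts G. \<forall>c\<in>q. c \<in> roots G \<and> v = s} = (if v = s then {roots G} else {})"
    using partitioned_treeD(6)[OF G] by auto
  then show "blocks (graft s F G) (Inl v)
      = (if v = s then insert (Inr ` roots G) else id) ((`) Inl ` blocks F v)"
    unfolding blocks_def graft_sel filter_image_Un by simp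
  show "blocks (graft s F G) (Inr w) = (`) Inr ` blocks G w"
    unfolding blocks_def graft_sel filter_image_Un using finite_parts(3)[OF F] by auto
qed

end

section \<open>Values of vertices and trees, and their compatibility with the products\<close>

context total_com_prelie
begin

text \<open>Edges go from a child down to its parent, so the recursion along \<open>edges F\<close>
  evaluates the children first. The brace is indexed by parts, and \<open>shprod f\<close> turns
  values of vertices into values of parts.\<close>

definition val :: "('d \<Rightarrow> 'a) \<Rightarrow> ('v, 'd) forest \<Rightarrow> 'v \<Rightarrow> 'a" where
  "val a F = wfrec (edges F) (\<lambda>f v. brace (a (dec F v)) (blocks F v) (shprod f))"

definition tval :: "('d \<Rightarrow> 'a) \<Rightarrow> ('v, 'd) forest \<Rightarrow> 'a" where
  "tval a F = shprod (val a F) (roots F)"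

lemma val_unfold:
  assumes F: "partitioned_tree F"
  shows "val a F v = brace (a (dec F v)) (blocks F v) (shprod (val a F))"
  unfolding val_def wfrec[OF partitioned_treeD(4)[OF F], of _ v]
  by (intro brace_cong finite_blocks[OF F] shprod_cong) (auto simp: blocks_def cut_apply)

text \<open>The value of a vertex depends only on what lies above it, so it suffices that
  \<open>S\<close> is closed under passing to children. This serves for isomorphisms, for merges and
  for the portions of a tree that a graft does not touch.\<close>

lemma val_transfer:
  assumes F: "partitioned_tree F" and G: "partitioned_tree G" and inj: "inj_on h S"
    and dec: "\<And>v. v \<in> S \<Longrightarrow> dec G (h v) = dec F v"
    and bl: "\<And>v. v \<in> S \<Longrightarrow> blocks G (h v) = (`) h ` blocks F v"
    and closed: "\<And>c v. v \<in> S \<Longrightarrow> (c, v) \<in> edges F \<Longrightarrow> c \<in> S"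
    and v: "v \<in> S"
  shows "val a G (h v) = val a F v"
  using v
proof (induction v rule: wf_induct_rule[OF partitioned_treeD(4)[OF F]])
  case (1 v)
  have sub: "p \<subseteq> S" if "p \<in> blocks F v" for p
    using that closed[OF 1(2)] by (auto simp: blocks_def)
  have inj': "inj_on ((`) h) (blocks F v)"
    by (rule inj_on_image) (use sub in \<open>auto intro: inj_on_subset[OF inj]\<close>)
  have "shprod (val a G) (h ` p) = shprod (val a F) p" if p: "p \<in> blocks F v" for p
  proof -
    have "shprod (val a G) (h ` p) = shprod (val a G \<circ> h) p"
      by (rule shprod_reindex[OF inj_on_subset[OF inj sub[OF p]]])
    also have "\<dots> = shprod (val a F) p"
      using p sub[OF p] 1(1) by (intro shprod_cong) (auto simp: blocks_def)
    finally show ?thesis .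
  qed
  then have eq: "(shprod (val a G) \<circ> (`) h) p = shprod (val a F) p" if "p \<in> blocks F v" for p
    using that by simp
  have "val a G (h v) = brace (a (dec F v)) (blocks F v) (shprod (val a G) \<circ> (`) h)"
    unfolding val_unfold[OF G, of a "h v"] bl[OF 1(2)] dec[OF 1(2)]
    by (rule brace_reindex[OF finite_blocks[OF F] inj'])
  also have "\<dots> = val a F v"
    unfolding val_unfold[OF F, of a v] by (rule brace_cong[OF finite_blocks[OF F] eq])
  finally show ?case .
qed

lemma tval_iso:
  assumes f: "forest_iso f F G" and F: "partitioned_tree F"
  shows "tval a G = tval a F"
proof -
  note F' = partitioned_treeD[OF F]
  have inj: "inj_on f (verts F)" using f by (simp add: forest_iso_def bij_betw_def)
  have "val a G (f v) = val a F v" if "v \<in> verts F" for v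
  proof (rule val_transfer[OF F partitioned_tree_iso[OF f F] inj])
    show "dec G (f v) = dec F v" if "v \<in> verts F" for v
      using f that by (simp add: forest_iso_def)
    show "c \<in> verts F" if "(c, v) \<in> edges F" for c v using that F'(2) by blast
    show "blocks G (f v) = (`) f ` blocks F v" if "v \<in> verts F" for v
      by (rule blocks_iso[OF f F that])
  qed (rule that)
  then have v: "(val a G \<circ> f) r = val a F r" if "r \<in> roots F" for r
    using that by (simp add: roots_def)
  have inj': "inj_on f (roots F)" by (rule inj_on_subset[OF inj]) (auto simp: roots_def)
  show ?thesis
    unfolding tval_def forest_iso_roots[OF f F'(2)] shprod_reindex[OF inj']
    using v by (rule shprod_cong)
qed

context
  fixes F :: "('v, 'd) forest" and G :: "('w, 'd) forest"
  assumes F: "partitioned_tree F" and G: "partitioned_tree G"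
begin

lemma tval_merge: "tval a (merge F G) = sh (tval a F) (tval a G)"
proof -
  note F' = partitioned_treeD[OF F] and G' = partitioned_treeD[OF G]
  note M = partitioned_tree_merge[OF F G]
  have l: "val a (merge F G) (Inl v) = val a F v" if "v \<in> verts F" for v
  proof (rule val_transfer[OF F M, of Inl "verts F"])
    show "c \<in> verts F" if "(c, v) \<in> edges F" for c v using that F'(2) by blast
  qed (use that in \<open>simp_all add: blocks_merge[OF F G]\<close>)
  have r: "val a (merge F G) (Inr v) = val a G v" if "v \<in> verts G" for v
  proof (rule val_transfer[OF G M, of Inr "verts G"])
    show "c \<in> verts G" if "(c, v) \<in> edges G" for c v using that G'(2) by blast
  qed (use that in \<open>simp_all add: blocks_merge[OF F G]\<close>)
  have fin: "finite (roots F)" "finite (roots G)" using F'(1) G'(1) by (auto simp: roots_def)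
  have "tval a (merge F G) = sh (shprod (val a (merge F G)) (Inl ` roots F)) (shprod (val a (merge F G)) (Inr ` roots G))"
    unfolding tval_def roots_merge[OF F G] Plus_def
    using F'(7) G'(7) fin by (intro shprod_union) auto
  also have "shprod (val a (merge F G)) (Inl ` roots F) = tval a F"
    unfolding tval_def shprod_reindex[OF inj_Inl] by (rule shprod_cong) (simp add: l roots_def)
  also have "shprod (val a (merge F G)) (Inr ` roots G) = tval a G"
    unfolding tval_def shprod_reindex[OF inj_Inr] by (rule shprod_cong) (simp add: r roots_def)
  finally show ?thesis .
qed

text \<open>Only the vertices on the path from \<open>s\<close> down to its root notice the graft;
  the others form a set closed under passing to children.\<close>

lemma val_graft_other:
  assumes s: "s \<in> verts F" and v: "v \<in> verts F" and "s \<notin> above F v"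
  shows "val a (graft s F G) (Inl v) = val a F v"
proof (rule val_transfer[OF F partitioned_tree_graft[OF F G s], of Inl "{v \<in> verts F. s \<notin> above F v}"])
  show "v \<in> {v \<in> verts F. s \<notin> above F v}" using assms by simp
  show "c \<in> {v \<in> verts F. s \<notin> above F v}" if "v \<in> {v \<in> verts F. s \<notin> above F v}" "(c, v) \<in> edges F" for c v
    using that partitioned_treeD(2)[OF F] rtrancl_into_rtrancl[of s c "edges F" v] by blast
  show "blocks (graft s F G) (Inl v) = (`) Inl ` blocks F v" if "v \<in> {v \<in> verts F. s \<notin> above F v}" for v
    using that by (auto simp: blocks_graft[OF F G])
qed simp_all

lemma val_graft_Inr:
  assumes s: "s \<in> verts F" and w: "w \<in> verts G"
  shows "val a (graft s F G) (Inr w) = val a G w"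
proof (rule val_transfer[OF G partitioned_tree_graft[OF F G s], of Inr "verts G"])
  show "c \<in> verts G" if "(c, v) \<in> edges G" for c v using that partitioned_treeD(2)[OF G] by blast
qed (use w in \<open>simp_all add: blocks_graft[OF F G]\<close>)

text \<open>The Leibniz rule lets \<open>c\<close> act on one member \<open>r\<close> of the part at
  a time. A vertex \<open>s\<close> above \<open>r\<close> is above no other member, so replacing
  the factor at \<open>r\<close> amounts to evaluating all factors in the grafted tree.\<close>

lemma pre_shprod_val:
  assumes p: "p \<in> parts F"
    and IH: "\<And>r. r \<in> p \<Longrightarrow> pre (val a F r) c = (\<Sum>s\<in>above F r. val a (graft s F G) (Inl r))"
  shows "pre (shprod (val a F) p) c
    = (\<Sum>r\<in>p. \<Sum>s\<in>above F r. shprod (\<lambda>x. val a (graft s F G) (Inl x)) p)"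
proof -
  note fp = finite_parts[OF F]
  have "pre (shprod (val a F) p) c = (\<Sum>r\<in>p. shprod ((val a F)(r := pre (val a F r) c)) p)"
    by (rule pre_shprod[OF fp(2,3)[OF p]])
  also have "\<dots> = (\<Sum>r\<in>p. \<Sum>s\<in>above F r. shprod ((val a F)(r := val a (graft s F G) (Inl r))) p)"
    using fp(2)[OF p] by (intro sum.cong refl) (simp only: IH shprod_upd_sum)
  also have "\<dots> = (\<Sum>r\<in>p. \<Sum>s\<in>above F r. shprod (\<lambda>x. val a (graft s F G) (Inl x)) p)"
  proof (intro sum.cong refl shprod_cong)
    fix r s x assume r: "r \<in> p" and s: "s \<in> above F r" and x: "x \<in> p"
    have v: "r \<in> verts F" "x \<in> verts F" using r x fp(4)[OF p] by auto
    have "s \<in> verts F" using finite_above(1)[OF F v(1)] s by blast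
    moreover have "s \<notin> above F x" if "x \<noteq> r"
      using above_disjoint_part[OF F p x r that] s by blast
    ultimately show "((val a F)(r := val a (graft s F G) (Inl r))) x = val a (graft s F G) (Inl x)"
      using val_graft_other[OF _ v(2)] by auto
  qed
  finally show ?thesis .
qed

text \<open>The recursion of the brace, solved for the prelie product: the brace with one more
  argument is the value for the graft on \<open>v\<close> itself, and the correction terms are, by
  induction and the Leibniz rule, the grafts strictly above \<open>v\<close>.\<close>

lemma pre_val:
  assumes "v \<in> verts F"
  shows "pre (val a F v) (tval a G) = (\<Sum>s\<in>above F v. val a (graft s F G) (Inl v))"
  using assms
proof (induction v rule: wf_induct_rule[OF partitioned_treeD(4)[OF F]])
  case (1 v)
  note F' = partitioned_treeD[OF F] and v = 1(2)
  define B f d c where "B = blocks F v" and "f = shprod (val a F)" and "d = a (dec F v)"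
    and "c = tval a G"
  have fin: "finite B" unfolding B_def by (rule finite_blocks[OF F])
  have Bp: "p \<in> parts F" "p \<subseteq> {r. (r, v) \<in> edges F}" if "p \<in> B" for p
    using that by (auto simp: B_def blocks_def)
  have child: "r \<in> verts F" "(r, v) \<in> edges F" if "p \<in> B" "r \<in> p" for r p
    using Bp[OF that(1)] that(2) F'(2) by auto
  have f_pre: "pre (f p) c = (\<Sum>r\<in>p. \<Sum>s\<in>above F r. shprod (\<lambda>x. val a (graft s F G) (Inl x)) p)"
    if "p \<in> B" for p
    unfolding f_def c_def using 1(1) child[OF that] by (intro pre_shprod_val Bp[OF that]) auto
  have tree: "partitioned_tree (graft s F G)" if "s \<in> verts F" for s
    by (rule partitioned_tree_graft[OF F G that])
  have f_same: "shprod (val a (graft s F G)) (Inl ` q) = shprod (\<lambda>x. val a (graft s F G) (Inl x)) q" for s q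
    by (simp add: shprod_reindex o_def)
  have f_other: "shprod (\<lambda>x. val a (graft s F G) (Inl x)) q = f q"
    if "q \<in> B" "s \<in> verts F" "\<And>x. x \<in> q \<Longrightarrow> s \<notin> above F x" for s q
    unfolding f_def using that child[OF that(1)] val_graft_other by (intro shprod_cong) auto
  have inj: "inj_on ((`) Inl) B" by (rule inj_image_Inl)

  \<comment> \<open>Values of the parts above \<open>v\<close> after the graft on \<open>v\<close>:
    the old parts keep theirs, and the new part has the value \<open>c\<close> of
    \<open>G\<close>.\<close>
  define W where "W = shprod (val a (graft v F G))"
  have WB: "W (Inl ` p) = f p" if "p \<in> B" for p
    unfolding W_def f_same using that v not_above_child[OF F] child[OF that]
    by (intro f_other) auto
  have WG: "W (Inr ` roots G) = c"
    unfolding W_def c_def tval_def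
      shprod_reindex[OF inj_Inr] by (rule shprod_cong) (simp add: roots_def val_graft_Inr v)
  have new: "Inr ` roots G \<notin> (`) Inl ` B" using partitioned_treeD(7)[OF G] by auto
  have upd: "brace d ((`) Inl ` B) (W(Inl ` p := y)) = brace d B (f(p := y))" if "p \<in> B" for p y
    unfolding brace_reindex[OF fin inj]
    using WB by (intro brace_cong fin) (auto simp: inj_image_eq_iff)
  have "val a (graft v F G) (Inl v) = brace d (insert (Inr ` roots G) ((`) Inl ` B)) W"
    unfolding val_unfold[OF tree[OF v], of a "Inl v"] by (simp add: blocks_graft[OF F G] B_def d_def W_def)
  also have "\<dots> = pre (brace d ((`) Inl ` B) W) c
      - (\<Sum>p\<in>(`) Inl ` B. brace d ((`) Inl ` B) (W(p := pre (W p) c)))"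
    using fin new by (simp add: brace_insert WG)
  also have "brace d ((`) Inl ` B) W = val a F v"
    unfolding brace_reindex[OF fin inj] val_unfold[OF F, of a v] B_def[symmetric] d_def[symmetric]
    using WB by (intro brace_cong fin) (auto simp: f_def)
  also have "(\<Sum>p\<in>(`) Inl ` B. brace d ((`) Inl ` B) (W(p := pre (W p) c)))
      = (\<Sum>p\<in>B. brace d B (f(p := pre (f p) c)))"
    unfolding sum.reindex[OF inj] o_def by (intro sum.cong refl) (simp only: upd WB)
  also have "\<dots> = (\<Sum>p\<in>B. \<Sum>r\<in>p. \<Sum>s\<in>above F r. val a (graft s F G) (Inl v))"
  proof (intro sum.cong refl)
    fix p assume p: "p \<in> B"
    have "brace d B (f(p := pre (f p) c)) = (\<Sum>r\<in>p. \<Sum>s\<in>above F r.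
        brace d B (f(p := shprod (\<lambda>x. val a (graft s F G) (Inl x)) p)))"
      by (simp only: f_pre[OF p] brace_upd_sum[OF fin p])
    also have "\<dots> = (\<Sum>r\<in>p. \<Sum>s\<in>above F r. val a (graft s F G) (Inl v))"
    proof (intro sum.cong refl)
      fix r s assume r: "r \<in> p" and s: "s \<in> above F r"
      note r' = child[OF p r]
      have sv: "s \<in> verts F" using finite_above(1)[OF F r'(1)] s by blast
      have "s \<noteq> v" using not_above_child[OF F r'(2)] s by blast
      \<comment> \<open>\<open>s\<close> lies above the child \<open>r\<close> in \<open>p\<close>
        and above no other child of \<open>v\<close>, so every part \<open>q \<noteq> p\<close>
        keeps its value in the grafted tree.\<close>
      have "(f(p := shprod (\<lambda>x. val a (graft s F G) (Inl x)) p)) q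
          = shprod (\<lambda>x. val a (graft s F G) (Inl x)) q" if q: "q \<in> B" for q
      proof (cases "q = p")
        case False
        have "s \<notin> above F x" if x: "x \<in> q" for x
        proof -
          have "x \<noteq> r"
            using False partition_on_eq[OF F'(5) Bp(1)[OF p] Bp(1)[OF q]] r x by blast
          then show ?thesis using above_disjoint[OF F, of r x] r' child[OF q x] s by blast
        qed
        then show ?thesis using f_other[OF q sv] False by simp
      qed simp
      then have "brace d B (f(p := shprod (\<lambda>x. val a (graft s F G) (Inl x)) p))
        = brace d B (\<lambda>q. shprod (val a (graft s F G)) (Inl ` q))"
        unfolding f_same by (intro brace_cong fin)
      also have "\<dots> = val a (graft s F G) (Inl v)"
        unfolding val_unfold[OF tree[OF sv], of a "Inl v"]
        using \<open>s \<noteq> v\<close> brace_reindex[OF fin inj, of d "shprod (val a (graft s F G))"]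
        by (simp add: blocks_graft[OF F G] B_def d_def o_def)
      finally show "brace d B (f(p := shprod (\<lambda>x. val a (graft s F G) (Inl x)) p))
        = val a (graft s F G) (Inl v)" .
    qed
    finally show "brace d B (f(p := pre (f p) c))
      = (\<Sum>r\<in>p. \<Sum>s\<in>above F r. val a (graft s F G) (Inl v))" .
  qed
  \<comment> \<open>Distinct parts are disjoint, and distinct children have disjoint sets of
    vertices above them, so the triple sum meets every vertex strictly above \<open>v\<close>
    exactly once.\<close>
  also have "\<dots> = (\<Sum>r\<in>\<Union>B. \<Sum>s\<in>above F r. val a (graft s F G) (Inl v))"
    using Bp(1) finite_parts(2)[OF F] partition_on_eq[OF F'(5)]
    by (intro sum.Union_disjoint[symmetric, unfolded o_def]) blast+
  also have "\<dots> = (\<Sum>s\<in>(\<Union>r\<in>\<Union>B. above F r). val a (graft s F G) (Inl v))"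
  proof (rule sum.UNION_disjoint[symmetric])
    show "finite (\<Union>B)" using fin Bp(1) finite_parts(2)[OF F] by auto
    show "\<forall>r\<in>\<Union>B. finite (above F r)" using finite_above(2)[OF F] child by blast
    show "\<forall>r\<in>\<Union>B. \<forall>r'\<in>\<Union>B. r \<noteq> r' \<longrightarrow> above F r \<inter> above F r' = {}"
      using above_disjoint[OF F] child(2) by blast
  qed
  finally have eq: "val a (graft v F G) (Inl v) = pre (val a F v) c
    - (\<Sum>s\<in>(\<Union>r\<in>\<Union>B. above F r). val a (graft s F G) (Inl v))" .
  have up: "above F v = insert v (\<Union>r\<in>\<Union>B. above F r)"
    unfolding B_def Union_blocks[OF F] by (rule above_unfold[OF F])
  moreover have "v \<notin> (\<Union>r\<in>\<Union>B. above F r)"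
    unfolding B_def Union_blocks[OF F] using not_above_child[OF F] by blast
  moreover have "finite (\<Union>r\<in>\<Union>B. above F r)"
    by (rule finite_subset[OF _ finite_above(2)[OF F v]]) (use up in blast)
  ultimately show ?case unfolding c_def[symmetric] using eq by (simp add: up)
qed

text \<open>The root part is evaluated like a part of children with no vertex underneath, so no
  brace occurs; the vertices above the roots are all vertices, each lying above one root.\<close>

lemma pre_tval: "pre (tval a F) (tval a G) = (\<Sum>s\<in>verts F. tval a (graft s F G))"
proof -
  note F' = partitioned_treeD[OF F]
  have r: "r \<in> verts F" if "r \<in> roots F" for r using that by (simp add: roots_def)
  have "pre (tval a F) (tval a G)
     = (\<Sum>r\<in>roots F. \<Sum>s\<in>above F r. shprod (\<lambda>x. val a (graft s F G) (Inl x)) (roots F))"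
    unfolding tval_def[of a F] using F'(6) r by (intro pre_shprod_val pre_val) auto
  also have "\<dots> = (\<Sum>r\<in>roots F. \<Sum>s\<in>above F r. tval a (graft s F G))"
    unfolding tval_def roots_graft[OF F G]
    by (simp add: shprod_reindex o_def)
  also have "\<dots> = (\<Sum>s\<in>verts F. tval a (graft s F G))"
    unfolding verts_eq_above_roots[OF F]
    using r finite_above(2)[OF F] above_disjoint[OF F] finite_parts(2)[OF F F'(6)]
    by (intro sum.UNION_disjoint[symmetric]) auto
  finally show ?thesis .
qed

end

lemma tval_single: 
  assumes "verts F = {v}" "edges F = {}" "parts F = {{v}}"
  shows "tval a F = a (dec F v)"
proof -
  have r: "roots F = {v}" using assms by (auto simp: roots_def)
  have F: "partitioned_tree F"
    by (rule partitioned_treeI) (use assms r in \<open>auto simp: partition_on_space\<close>)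
  have "blocks F v = {}" using assms by (auto simp: blocks_def)
  then show ?thesis by (simp add: tval_def r val_unfold[OF F, of a v])
qed

end

section \<open>Decomposition of partitioned trees and uniqueness\<close>

text \<open>The partition is supplied separately, because splitting off one root breaks up the part
  formed by the roots.\<close>

definition restr :: "('v, 'd) forest \<Rightarrow> 'v set \<Rightarrow> 'v set set \<Rightarrow> ('v, 'd) forest" where
  "restr F S P = \<lparr>verts = S, edges = edges F \<inter> S \<times> S, parts = P, dec = dec F\<rparr>"

lemma restr_sel [simp]:
  "verts (restr F S P) = S" "edges (restr F S P) = edges F \<inter> S \<times> S"
  "parts (restr F S P) = P" "dec (restr F S P) = dec F"
  by (simp_all add: restr_def)

lemma roots_restr: "roots (restr F S P) = {x \<in> S. \<forall>z\<in>S. (x, z) \<notin> edges F}"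
  by (auto simp: roots_def)

text \<open>The members of an inherited part share a vertex \<open>z\<close> in \<open>F\<close>.
  They are not roots of the restriction, so they have an edge inside \<open>S\<close>, and by
  single-valuedness it leads to \<open>z\<close>.\<close>

lemma partitioned_tree_restr:
  assumes F: "partitioned_tree F" and S: "S \<subseteq> verts F" and P: "partition_on S P"
    and R: "roots (restr F S P) \<in> P"
    and parts: "\<And>p. p \<in> P \<Longrightarrow> p \<noteq> roots (restr F S P) \<Longrightarrow> p \<in> parts F \<and> p \<noteq> roots F"
  shows "partitioned_tree (restr F S P)"
proof (rule partitioned_treeI)
  note F' = partitioned_treeD[OF F]
  show "finite (verts (restr F S P))" using S F'(1) by (simp add: finite_subset)
  show "single_valued (edges (restr F S P))"
    using F'(3) by (auto simp: single_valued_def)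
  show "wf (edges (restr F S P))" by (rule wf_subset[OF F'(4)]) auto
  fix p x y assume p: "p \<in> parts (restr F S P)" "p \<noteq> roots (restr F S P)" and x: "x \<in> p" and y: "y \<in> p"
  have p': "p \<in> P" using p by simp
  obtain z where z: "(x, z) \<in> edges F" "(y, z) \<in> edges F"
    using F'(8)[of p x y] parts[OF p' p(2)] x y by blast
  have "x \<in> S" "y \<in> S" using x y p' partition_onD1[OF P] by blast+
  moreover have "x \<notin> roots (restr F S P)" using partition_on_eq[OF P p' R x] p(2) by blast
  ultimately obtain z' where "(x, z') \<in> edges F" "z' \<in> S" by (auto simp: roots_restr)
  moreover from this have "z' = z" using z F'(3) by (auto dest: single_valuedD)
  ultimately show "\<exists>z. (x, z) \<in> edges (restr F S P) \<and> (y, z) \<in> edges (restr F S P)"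
    using z \<open>x \<in> S\<close> \<open>y \<in> S\<close> by auto
qed (use P R in auto)

lemma partition_on_split:
  assumes P: "partition_on V P" and S: "S \<subseteq> V" and split: "\<And>q. q \<in> P \<Longrightarrow> q \<subseteq> S \<or> q \<inter> S = {}"
  shows "partition_on S {q \<in> P. q \<subseteq> S}" "partition_on (V - S) {q \<in> P. q \<inter> S = {}}"
proof -
  have U: "\<Union>P = V" using partition_onD1[OF P] by simp
  show "partition_on S {q \<in> P. q \<subseteq> S}"
  proof (rule partition_onI)
    show "\<Union>{q \<in> P. q \<subseteq> S} = S" using U S split by blast
    show "disjnt p q" if "p \<in> {q \<in> P. q \<subseteq> S}" "q \<in> {q \<in> P. q \<subseteq> S}" "p \<noteq> q" for p q
      using that partition_on_eq[OF P] unfolding disjnt_iff by blast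
    show "{} \<notin> {q \<in> P. q \<subseteq> S}" using partition_onD3[OF P] by simp
  qed
  show "partition_on (V - S) {q \<in> P. q \<inter> S = {}}"
  proof (rule partition_onI)
    show "\<Union>{q \<in> P. q \<inter> S = {}} = V - S" using U S split by blast
    show "disjnt p q" if "p \<in> {q \<in> P. q \<inter> S = {}}" "q \<in> {q \<in> P. q \<inter> S = {}}" "p \<noteq> q" for p q
      using that partition_on_eq[OF P] unfolding disjnt_iff by blast
    show "{} \<notin> {q \<in> P. q \<inter> S = {}}" using partition_onD3[OF P] by simp
  qed
qed

text \<open>The pieces of a cut tree are disjoint subsets of its vertices;
  \<open>case_sum id id\<close> glues them together again.\<close>

lemma bij_betw_case_sum_id: "A \<inter> B = {} \<Longrightarrow> bij_betw (case_sum id id) (A <+> B) (A \<union> B)"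
  by (rule bij_betw_imageI) (auto intro!: inj_onI simp: Plus_def image_Un image_image)

lemma image_case_sum_id [simp]:
  "case_sum id id ` Inl ` A = A" "case_sum id id ` Inr ` B = B"
  "case_sum id id ` (A <+> B) = A \<union> B"
  by (simp_all add: Plus_def image_Un image_image)

lemma image_image_case_sum_id [simp]:
  "(`) (case_sum id id) ` (`) Inl ` P = P" "(`) (case_sum id id) ` (`) Inr ` Q = Q"
  by (simp_all add: image_image)

lemma image_map_prod_case_sum_id [simp]:
  "map_prod (case_sum id id) (case_sum id id) ` map_prod Inl Inl ` E = E"
  "map_prod (case_sum id id) (case_sum id id) ` map_prod Inr Inr ` E' = E'"
  by (simp_all add: image_image map_prod_def case_prod_unfold)

text \<open>Cuts off \<open>S\<close>, the part \<open>p\<close> with everything above it. The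
  strict inclusion of the children of \<open>r\<close> is recorded for the induction measure of the
  uniqueness proof.\<close>

lemma split_graft:
  assumes F: "partitioned_tree F" and r: "roots F = {r}" and p: "p \<in> blocks F r"
  obtains F1 F2 where "partitioned_tree F1" "partitioned_tree F2"
    "forest_iso (case_sum id id) (graft r F1 F2) F" "roots F1 = {r}"
    "{c. (c, r) \<in> edges F1} \<subset> {c. (c, r) \<in> edges F}"
    "verts F1 \<union> verts F2 = verts F" "verts F1 \<inter> verts F2 = {}" "dec F1 = dec F" "dec F2 = dec F"
proof -
  note F' = partitioned_treeD[OF F]
  have pp: "p \<in> parts F" "p \<subseteq> verts F" and pr: "\<And>c. c \<in> p \<Longrightarrow> (c, r) \<in> edges F"
    using p finite_parts(4)[OF F] by (auto simp: blocks_def)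
  define S where "S = (\<Union>c\<in>p. above F c)"
  have SV: "S \<subseteq> verts F" unfolding S_def using finite_above(1)[OF F] pp by blast
  have pS: "p \<subseteq> S" by (auto simp: S_def)
  have up: "x \<in> S" if "(x, z) \<in> edges F" "z \<in> S" for x z
    using that by (auto simp: S_def intro: converse_rtrancl_into_rtrancl)
  \<comment> \<open>The only edges that leave \<open>S\<close> are those from \<open>p\<close> to
    \<open>r\<close>.\<close>
  have down: "z \<in> S" if xz: "(x, z) \<in> edges F" and xS: "x \<in> S" "x \<notin> p" for x z
  proof -
    from xS obtain c where c: "c \<in> p" "(x, c) \<in> (edges F)\<^sup>*" "x \<noteq> c" by (auto simp: S_def)
    then obtain u where "(x, u) \<in> edges F" "(u, c) \<in> (edges F)\<^sup>*" by (meson converse_rtranclE)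
    moreover from this have "u = z" using xz F'(3) by (auto dest: single_valuedD)
    ultimately show ?thesis using c(1) by (auto simp: S_def)
  qed
  have rS: "r \<notin> S" unfolding S_def using not_above_child[OF F] pr by blast
  have rV: "r \<in> verts F" using r by (auto simp: roots_def)
  \<comment> \<open>No part straddles the cut: a part that meets \<open>p\<close> is
    \<open>p\<close>, and a part with another member in \<open>S\<close> hangs on a vertex of
    \<open>S\<close>, so all of it lies in \<open>S\<close> by \<open>up\<close>.\<close>
  have dichotomy: "q \<subseteq> S \<or> q \<inter> S = {}" if q: "q \<in> parts F" for q
  proof (cases "q \<inter> S = {}")
    case False
    then obtain x where x: "x \<in> q" "x \<in> S" by blast
    show ?thesis
    proof (cases "x \<in> p")
      case True
      then show ?thesis using partition_on_eq[OF F'(5) q pp(1) x(1)] pS by simp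
    next
      case np: False
      have "q \<noteq> roots F" using x rS r by auto
      have "y \<in> S" if y: "y \<in> q" for y
      proof -
        obtain z where "(x, z) \<in> edges F" "(y, z) \<in> edges F"
          using F'(8)[OF q \<open>q \<noteq> roots F\<close> x(1) y] by blast
        then show ?thesis using up down x np by blast
      qed
      then show ?thesis by blast
    qed
  qed simp
  define P1 P2 where "P1 = {q \<in> parts F. q \<inter> S = {}}" and "P2 = {q \<in> parts F. q \<subseteq> S}"
  have part: "partition_on (verts F - S) P1" "partition_on S P2"
    unfolding P1_def P2_def using partition_on_split[OF F'(5) SV dichotomy] by simp_all
  define F1 F2 where "F1 = restr F (verts F - S) P1" and "F2 = restr F S P2"
  have "{x \<in> verts F - S. \<forall>z\<in>verts F - S. (x, z) \<notin> edges F} = {r}"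
    using r rS rV up F'(2) unfolding roots_def by blast
  then have r1: "roots F1 = {r}" by (simp add: F1_def roots_restr)
  have "{x \<in> S. \<forall>z\<in>S. (x, z) \<notin> edges F} = p"
  proof (intro equalityI subsetI)
    fix x assume "x \<in> {x \<in> S. \<forall>z\<in>S. (x, z) \<notin> edges F}"
    then have x: "x \<in> S" "\<And>z. z \<in> S \<Longrightarrow> (x, z) \<notin> edges F" by auto
    then have "x \<noteq> r" "x \<in> verts F" using rS SV by auto
    then obtain z where "(x, z) \<in> edges F" using r by (auto simp: roots_def)
    then show "x \<in> p" using down x by blast
  next
    fix x assume x: "x \<in> p"
    have "(x, z) \<notin> edges F" if "z \<in> S" for z
      using pr[OF x] F'(3) rS that by (auto dest: single_valuedD)
    then show "x \<in> {x \<in> S. \<forall>z\<in>S. (x, z) \<notin> edges F}" using x pS by blast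
  qed
  then have r2: "roots F2 = p" by (simp add: F2_def roots_restr)
  have t1: "partitioned_tree F1"
  proof (rule partitioned_tree_restr[OF F _ part(1), folded F1_def], unfold r1)
    show "{r} \<in> P1" using F'(6) r rS by (auto simp: P1_def)
  qed (auto simp: P1_def r)
  have t2: "partitioned_tree F2"
  proof (rule partitioned_tree_restr[OF F SV part(2), folded F2_def], unfold r2)
    show "p \<in> P2" using pp pS by (simp add: P2_def)
  qed (use rS r in \<open>auto simp: P2_def\<close>)
  have E: "edges F = edges F1 \<union> edges F2 \<union> (\<lambda>c. (c, r)) ` p"
  proof (intro equalityI subsetI)
    fix e assume e: "e \<in> edges F"
    obtain x z where xz: "e = (x, z)" by (cases e)
    have V: "x \<in> verts F" "z \<in> verts F" using e F'(2) xz by auto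
    consider "x \<in> p" | "x \<in> S" "x \<notin> p" | "x \<notin> S" by blast
    then show "e \<in> edges F1 \<union> edges F2 \<union> (\<lambda>c. (c, r)) ` p"
    proof cases
      case 1
      then have "z = r" using pr e xz F'(3) by (auto dest: single_valuedD)
      then show ?thesis using 1 xz by blast
    next
      case 2
      then show ?thesis using down e xz by (auto simp: F2_def)
    next
      case 3
      then show ?thesis using up e xz V by (auto simp: F1_def)
    qed
  qed (auto simp: F1_def F2_def pr)
  have "forest_iso (case_sum id id) (graft r F1 F2) F"
    unfolding forest_iso_def
  proof (intro conjI)
    show "bij_betw (case_sum id id) (verts (graft r F1 F2)) (verts F)"
      using bij_betw_case_sum_id[of "verts F - S" S] SV
      by (simp add: F1_def F2_def Un_absorb2 Int_commute)
    show "edges F = map_prod (case_sum id id) (case_sum id id) ` edges (graft r F1 F2)"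
      unfolding E by (simp add: graft_def image_Un r2) (simp add: image_image)
    show "parts F = (`) (case_sum id id) ` parts (graft r F1 F2)"
      using dichotomy by (auto simp: image_Un F1_def F2_def P1_def P2_def)
    show "\<forall>v\<in>verts (graft r F1 F2). dec F (case_sum id id v) = dec (graft r F1 F2) v"
      by (auto simp: F1_def F2_def)
  qed
  moreover have "{c. (c, r) \<in> edges F1} \<subset> {c. (c, r) \<in> edges F}"
  proof -
    obtain c where c: "c \<in> p" using finite_parts(3)[OF F pp(1)] by blast
    then have "(c, r) \<in> edges F" "(c, r) \<notin> edges F1" using pr pS by (auto simp: F1_def)
    then show ?thesis by (auto simp: F1_def)
  qed
  ultimately show ?thesis
    using t1 t2 r1 SV by (intro that[of F1 F2]) (auto simp: F1_def F2_def)
qed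

text \<open>Separates the root \<open>r\<close> and everything above it from the rest. No edge joins
  the two pieces, and the part of the roots is the only one broken up, which is what
  \<open>merge\<close> repairs.\<close>

lemma split_merge:
  assumes F: "partitioned_tree F" and r: "r \<in> roots F" and ne: "roots F \<noteq> {r}"
  obtains F1 F2 where "partitioned_tree F1" "partitioned_tree F2"
    "forest_iso (case_sum id id) (merge F1 F2) F"
    "verts F1 \<union> verts F2 = verts F" "verts F1 \<inter> verts F2 = {}" "dec F1 = dec F" "dec F2 = dec F"
proof -
  note F' = partitioned_treeD[OF F]
  define S where "S = above F r"
  have rV: "r \<in> verts F" and RV: "roots F \<subseteq> verts F" using r by (auto simp: roots_def)
  have SV: "S \<subseteq> verts F" unfolding S_def using finite_above(1)[OF F rV] .
  have rS: "r \<in> S" by (simp add: S_def)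
  have RS: "roots F \<inter> S = {r}"
  proof -
    have "x = r" if x: "x \<in> roots F" "x \<in> S" for x
      using above_disjoint[OF F, of x r] x r by (auto simp: S_def)
    then show ?thesis using r rS by blast
  qed
  have up: "x \<in> S" if "(x, z) \<in> edges F" "z \<in> S" for x z
    using that by (auto simp: S_def intro: converse_rtrancl_into_rtrancl)
  have down: "z \<in> S" if xz: "(x, z) \<in> edges F" and xS: "x \<in> S" for x z
  proof -
    have "x \<noteq> r" using xz r by (auto simp: roots_def)
    moreover have "(x, r) \<in> (edges F)\<^sup>*" using xS by (simp add: S_def)
    ultimately obtain u where "(x, u) \<in> edges F" "(u, r) \<in> (edges F)\<^sup>*"
      by (meson converse_rtranclE)
    moreover from this have "u = z" using xz F'(3) by (auto dest: single_valuedD)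
    ultimately show ?thesis by (simp add: S_def)
  qed
  define P where "P = parts F - {roots F}"
  have P: "partition_on (verts F - roots F) P"
    unfolding P_def by (rule partition_on_remove[OF F'(5,6)])
  have PR: "q \<inter> roots F = {}" if "q \<in> P" for q
    using partition_onD1[OF P] that by blast
  have dichotomy: "q \<subseteq> S - {r} \<or> q \<inter> (S - {r}) = {}" if q: "q \<in> P" for q
  proof (cases "q \<inter> S = {}")
    case False
    then obtain x where x: "x \<in> q" "x \<in> S" by blast
    have "y \<in> S" if "y \<in> q" for y
      using F'(8)[of q x y] q x that up down by (auto simp: P_def)
    moreover have "r \<notin> q" using PR[OF q] r by blast
    ultimately show ?thesis by blast
  qed blast
  have S': "S - {r} \<subseteq> verts F - roots F" using SV RS by blast
  \<comment> \<open>Parts in \<open>P\<close> contain no roots, so avoiding \<open>S - {r}\<close>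
    is the same as avoiding \<open>S\<close>.\<close>
  define P1 P2 where "P1 = {q \<in> P. q \<subseteq> S - {r}}" and "P2 = {q \<in> P. q \<inter> (S - {r}) = {}}"
  define R where "R = roots F - {r}"
  have part: "partition_on (S - {r}) P1" "partition_on (verts F - roots F - (S - {r})) P2"
    unfolding P1_def P2_def using partition_on_split[OF P S' dichotomy] by simp_all
  have P0: "P = P1 \<union> P2" using dichotomy by (auto simp: P1_def P2_def)
  have "partition_on ((S - {r}) \<union> {r}) (P1 \<union> {{r}})"
    by (intro partition_on_union part partition_on_space) auto
  moreover have "(S - {r}) \<union> {r} = S" using rS by blast
  ultimately have part1: "partition_on S (insert {r} P1)" by simp
  have "partition_on ((verts F - roots F - (S - {r})) \<union> R) (P2 \<union> {R})"
    unfolding R_def using r ne by (intro partition_on_union part partition_on_space) auto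
  moreover have "(verts F - roots F - (S - {r})) \<union> R = verts F - S"
    unfolding R_def using RS RV rS by blast
  ultimately have part2: "partition_on (verts F - S) (insert R P2)" by simp
  define F1 F2 where "F1 = restr F S (insert {r} P1)" and "F2 = restr F (verts F - S) (insert R P2)"
  have "{x \<in> S. \<forall>z\<in>S. (x, z) \<notin> edges F} = {r}"
    using RS SV down unfolding roots_def by blast
  then have r1: "roots F1 = {r}" by (simp add: F1_def roots_restr)
  have "{x \<in> verts F - S. \<forall>z\<in>verts F - S. (x, z) \<notin> edges F} = R"
    using RS up F'(2) unfolding roots_def R_def by blast
  then have r2: "roots F2 = R" by (simp add: F2_def roots_restr)
  have t1: "partitioned_tree F1"
    by (rule partitioned_tree_restr[OF F SV part1, folded F1_def], unfold r1) (auto simp: P1_def P_def)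
  have t2: "partitioned_tree F2"
    by (rule partitioned_tree_restr[OF F _ part2, folded F2_def], unfold r2) (auto simp: P2_def P_def)
  have E: "edges F = edges F1 \<union> edges F2"
  proof (intro equalityI subsetI)
    fix e assume e: "e \<in> edges F"
    obtain x z where xz: "e = (x, z)" by (cases e)
    have "x \<in> verts F" "z \<in> verts F" using e F'(2) xz by auto
    moreover have "x \<in> S \<longleftrightarrow> z \<in> S" using up[of x z] down[of x z] e xz by blast
    ultimately show "e \<in> edges F1 \<union> edges F2" using e xz by (simp add: F1_def F2_def)
  qed (auto simp: F1_def F2_def)
  \<comment> \<open>\<open>merge\<close> removes the root parts of both pieces; since these differ
    from the parts inherited from \<open>F\<close>, exactly \<open>P1\<close> and \<open>P2\<close>
    remain.\<close>
  have "{r} \<notin> P1" "R \<notin> P2"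
  proof -
    show "{r} \<notin> P1" by (auto simp: P1_def)
    show "R \<notin> P2" using PR[of R] r ne by (auto simp: P2_def R_def)
  qed
  then have d: "insert {r} P1 - {{r}} = P1" "insert R P2 - {R} = P2" by auto
  have "forest_iso (case_sum id id) (merge F1 F2) F"
    unfolding forest_iso_def
  proof (intro conjI)
    show "bij_betw (case_sum id id) (verts (merge F1 F2)) (verts F)"
      using bij_betw_case_sum_id[of S "verts F - S"] SV
      by (simp add: F1_def F2_def Un_absorb1)
    show "edges F = map_prod (case_sum id id) (case_sum id id) ` edges (merge F1 F2)"
      unfolding E by (simp add: merge_def image_Un)
    have "parts F = insert (roots F) P" using F'(6) by (auto simp: P_def)
    moreover have "{r} \<union> R = roots F" using r by (auto simp: R_def)
    ultimately show "parts F = (`) (case_sum id id) ` parts (merge F1 F2)"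
      unfolding merge_sel r1 r2 by (simp add: F1_def F2_def d image_Un P0 del: Un_insert_left)
    show "\<forall>v\<in>verts (merge F1 F2). dec F (case_sum id id v) = dec (merge F1 F2) v"
      by (auto simp: F1_def F2_def)
  qed
  then show ?thesis
    using t1 t2 SV by (intro that[of F1 F2]) (auto simp: F1_def F2_def)
qed

text \<open>Its cardinality is the second component of the measure in the uniqueness proof.\<close>

definition root_children :: "('v, 'd) forest \<Rightarrow> 'v set" where
  "root_children F = {c. \<exists>r\<in>roots F. (c, r) \<in> edges F}"

lemma forest_iso_root_children:
  assumes f: "forest_iso f F G" and F: "partitioned_tree F"
  shows "card (root_children G) = card (root_children F)"
proof -
  note F' = partitioned_treeD[OF F]
  have inj: "inj_on f (verts F)" and e: "edges G = map_prod f f ` edges F"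
    using f by (auto simp: forest_iso_def bij_betw_def)
  have "root_children G = f ` root_children F"
  proof (intro equalityI subsetI)
    fix c assume "c \<in> root_children G"
    then obtain r x y where r: "r \<in> roots F" and xy: "(x, y) \<in> edges F" "c = f x" "f y = f r"
      by (auto simp: root_children_def forest_iso_roots[OF f F'(2)] e)
    moreover from this have "y = r" using F'(2) by (intro inj_onD[OF inj]) (auto simp: roots_def)
    ultimately show "c \<in> f ` root_children F" by (auto simp: root_children_def)
  next
    fix c assume "c \<in> f ` root_children F"
    then show "c \<in> root_children G"
      by (force simp: root_children_def forest_iso_roots[OF f F'(2)] e)
  qed
  moreover have "inj_on f (root_children F)"
    using F'(2) by (intro inj_on_subset[OF inj]) (auto simp: root_children_def)
  ultimately show ?thesis by (simp add: card_image)
qed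

section \<open>Uniqueness of the morphism\<close>

lemma (in com_prelie_hom) map_zero: "\<phi> 0 = 0"
  using map_add[of 0 0] dom.subspace_0[OF dom.subspace] by simp

lemma (in com_prelie_hom) map_sum:
  assumes "\<And>i. i \<in> I \<Longrightarrow> y i \<in> A"
  shows "\<phi> (\<Sum>i\<in>I. y i) = (\<Sum>i\<in>I. \<phi> (y i))"
  using assms
proof (induction I rule: infinite_finite_induct)
  case (insert i I)
  then show ?case using dom.subspace_sum[OF dom.subspace, of I y] by (simp add: map_add)
qed (simp_all add: map_zero)

definition dot_tree :: "'d \<Rightarrow> (nat, 'd) forest" where
  "dot_tree d = \<lparr>verts = {0}, edges = {}, parts = {{0}}, dec = \<lambda>_. d\<rparr>"

lemma single_dot: "Poly_Mapping.single (dot d) 1 = basis (dot_tree d)"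
  by (simp add: basis_def dot_def dot_tree_def)

lemma partitioned_tree_dot: "partitioned_tree (dot_tree d)"
  by (rule partitioned_treeI) (auto simp: dot_tree_def roots_def partition_on_space)

lemma basis_no_blocks:
  assumes F: "partitioned_tree F" and r: "roots F = {r}" and "blocks F r = {}"
  shows "verts F = {r}" "basis F = basis (dot_tree (dec F r))"
proof -
  note F' = partitioned_treeD[OF F]
  have "above F r = {r}"
    using assms(3) Union_blocks[OF F, of r] above_unfold[OF F, of r] by auto
  then show v: "verts F = {r}" using verts_eq_above_roots[OF F] r by simp
  have "r \<in> roots F" by (simp add: r)
  then have "(r, w) \<notin> edges F" for w by (simp add: roots_def)
  then have "edges F = {}" using F'(2) unfolding v by auto
  moreover have "parts F = {{r}}"
  proof (intro equalityI subsetI)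
    fix p assume p: "p \<in> parts F"
    have "p \<noteq> {}" "p \<subseteq> {r}" using finite_parts(3,4)[OF F p] v by simp_all
    then show "p \<in> {{r}}" by (simp add: subset_singleton_iff)
  next
    fix p assume "p \<in> {{r}}"
    then show "p \<in> parts F" using F'(6) by (simp add: r)
  qed
  ultimately have "forest_iso (\<lambda>_. 0) F (dot_tree (dec F r))"
    by (simp add: forest_iso_def dot_tree_def v bij_betw_def)
  then show "basis F = basis (dot_tree (dec F r))" using F by (rule basis_iso)
qed

lemma com_prelie_hom_unique:
  fixes D :: "'d set" and A :: "'a::ab_group_add set" and scale :: "'k::field_char_0 \<Rightarrow> 'a \<Rightarrow> 'a"
  assumes \<phi>: "com_prelie_hom g_scale (gPT D) g_pre g_sh scale A pre sh \<phi>"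
    and \<psi>: "com_prelie_hom g_scale (gPT D) g_pre g_sh scale A pre sh \<psi>"
    and dots: "\<And>d. d \<in> D \<Longrightarrow> \<phi> (Poly_Mapping.single (dot d) 1) = \<psi> (Poly_Mapping.single (dot d) 1)"
    and x: "x \<in> gPT D"
  shows "\<phi> x = \<psi> x"
proof -
  interpret \<phi>: com_prelie_hom g_scale "gPT D" g_pre g_sh scale A pre sh \<phi> by (rule \<phi>)
  interpret \<psi>: com_prelie_hom g_scale "gPT D" g_pre g_sh scale A pre sh \<psi> by (rule \<psi>)
  have basis: "\<phi> (basis F) = \<psi> (basis F)" if "partitioned_tree F" "dec F ` verts F \<subseteq> D"
    for F :: "(nat, 'd) forest"
    using that
  \<comment> \<open>The order is lexicographic: the terms of the prelie product other than
    \<open>F\<close> have as many vertices as \<open>F\<close> and go down in the second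
    component.\<close>
  proof (induction F rule: wf_induct_rule[OF wf_measures[of "[\<lambda>F. card (verts F), \<lambda>F. card (root_children F)]"]])
    case (1 F)
    note F = 1(2) and D = 1(3) and F' = partitioned_treeD[OF 1(2)]
    have IH: "\<phi> (basis G) = \<psi> (basis G)"
      if "partitioned_tree G" "dec G ` verts G \<subseteq> D" "card (verts G) < card (verts F)"
      for G :: "(nat, 'd) forest"
      using 1(1)[of G] that by simp
    \<comment> \<open>These terms have vertices in \<open>nat + nat\<close>, while the induction
      ranges over trees on \<open>nat\<close>; both measures are invariant under passing to an
      isomorphic copy.\<close>
    have IH': "\<phi> (basis G) = \<psi> (basis G)"
      if G: "partitioned_tree G" "dec G ` verts G \<subseteq> D" "card (verts G) = card (verts F)"
        "card (root_children G) < card (root_children F)"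
      for G :: "(nat + nat, 'd) forest"
    proof -
      obtain H :: "(nat, 'd) forest" and f where f: "forest_iso f G H"
        using ex_nat_iso[OF partitioned_treeD(1)[OF G(1)]] by (auto simp: isoclass_def)
      have "card (verts H) = card (verts G)"
        using f by (auto simp: forest_iso_def dest: bij_betw_same_card)
      then have "\<phi> (basis H) = \<psi> (basis H)"
        using 1(1)[of H] G partitioned_tree_iso[OF f G(1)] forest_iso_dec[OF f]
          forest_iso_root_children[OF f G(1)] by simp
      then show ?thesis by (simp add: basis_iso[OF f G(1)])
    qed
    obtain r where r: "r \<in> roots F" using F'(7) by blast
    show ?case
    proof (cases "roots F = {r}")
      case False
      obtain F1 F2 where s: "partitioned_tree F1" "partitioned_tree F2"
        "forest_iso (case_sum id id) (merge F1 F2) F"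
        "verts F1 \<union> verts F2 = verts F" "verts F1 \<inter> verts F2 = {}" "dec F1 = dec F" "dec F2 = dec F"
        using split_merge[OF F r False] by blast
      have ne: "verts F1 \<noteq> {}" "verts F2 \<noteq> {}" using s(1,2) by (simp_all add: partitioned_tree_def)
      then have "verts F1 \<subset> verts F" "verts F2 \<subset> verts F" using s(4,5) by blast+
      then have c: "card (verts F1) < card (verts F)" "card (verts F2) < card (verts F)"
        using F'(1) by (simp_all add: psubset_card_mono)
      have d: "dec F1 ` verts F1 \<subseteq> D" "dec F2 ` verts F2 \<subseteq> D" using D s(4,6,7) by auto
      have "basis F = (g_sh (basis F1) (basis F2) :: _ \<Rightarrow>\<^sub>0 'k)"
        using s by (simp add: g_sh_basis partitioned_tree_merge basis_iso[OF s(3)])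
      then show ?thesis
        using IH[OF s(1) d(1) c(1)] IH[OF s(2) d(2) c(2)] s(1,2) d
        by (simp add: \<phi>.map_sh \<psi>.map_sh basis_in_gPT)
    next
      case root: True
      show ?thesis
      proof (cases "blocks F r = {}")
        case True
        have "dec F r \<in> D" using D r by (auto simp: roots_def)
        then show ?thesis
          using dots[of "dec F r"] by (simp add: single_dot basis_no_blocks(2)[OF F root True])
      next
        case False
        then obtain p where p: "p \<in> blocks F r" by blast
        obtain F1 F2 where s: "partitioned_tree F1" "partitioned_tree F2"
          "forest_iso (case_sum id id) (graft r F1 F2) F" "roots F1 = {r}"
          "{c. (c, r) \<in> edges F1} \<subset> {c. (c, r) \<in> edges F}"
          "verts F1 \<union> verts F2 = verts F" "verts F1 \<inter> verts F2 = {}" "dec F1 = dec F" "dec F2 = dec F"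
          using split_graft[OF F root p] by blast
        have ne: "verts F1 \<noteq> {}" "verts F2 \<noteq> {}" using s(1,2) by (simp_all add: partitioned_tree_def)
        then have "verts F1 \<subset> verts F" "verts F2 \<subset> verts F" using s(6,7) by blast+
        then have c: "card (verts F1) < card (verts F)" "card (verts F2) < card (verts F)"
          using F'(1) by (simp_all add: psubset_card_mono)
        have d: "dec F1 ` verts F1 \<subseteq> D" "dec F2 ` verts F2 \<subseteq> D" using D s(6,8,9) by auto
        have r1: "r \<in> verts F1" using s(4) by (auto simp: roots_def)
        have fin: "finite (verts F1)" "finite (verts F2)" using s(1,2) by (simp_all add: partitioned_treeD)
        note tree = partitioned_tree_graft[OF s(1,2)]
        have dg: "dec (graft s F1 F2) ` verts (graft s F1 F2) \<subseteq> D" for s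
          unfolding dec_graft[OF s(1,2)] using d by simp
        \<comment> \<open>The grafts on vertices other than \<open>r\<close>; the graft on
          \<open>r\<close> gives \<open>F\<close> back, so \<open>basis F\<close> is the prelie
          product minus \<open>R\<close>.\<close>
        define R where "R = (\<Sum>s\<in>verts F1 - {r}. basis (graft s F1 F2) :: _ \<Rightarrow>\<^sub>0 'k)"
        have "g_pre (basis F1) (basis F2) = basis (graft r F1 F2) + R"
          unfolding g_pre_basis[OF s(1,2)] R_def by (rule sum.remove[OF fin(1) r1])
        also have "basis (graft r F1 F2) = (basis F :: _ \<Rightarrow>\<^sub>0 'k)"
          by (rule basis_iso[OF s(3) tree[OF r1]])
        finally have eq: "g_pre (basis F1) (basis F2) = basis F + R" .
        have mem: "(basis (graft s F1 F2) :: _ \<Rightarrow>\<^sub>0 'k) \<in> gPT D" if "s \<in> verts F1 - {r}" for s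
          using that by (intro basis_in_gPT tree dg) simp
        then have R: "R \<in> gPT D" unfolding R_def by (rule g.subspace_sum[OF subspace_gPT])
        have "\<phi> (basis (graft s F1 F2)) = \<psi> (basis (graft s F1 F2))" if s': "s \<in> verts F1 - {r}" for s
        proof (rule IH'[OF tree dg])
          show "s \<in> verts F1" using s' by simp
          have "card (verts F1 <+> verts F2) = card (verts F1 \<union> verts F2)"
            using fin s(7) by (simp add: card_Plus card_Un_disjoint)
          then show "card (verts (graft s F1 F2)) = card (verts F)" by (simp add: s(6))
          \<comment> \<open>For \<open>s \<noteq> r\<close> the root has only the children it has in
            \<open>F1\<close>, from which \<open>p\<close> has been cut off.\<close>
          have "root_children (graft s F1 F2) = Inl ` {c. (c, r) \<in> edges F1}"
          proof (intro set_eqI)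
            fix c show "c \<in> root_children (graft s F1 F2) \<longleftrightarrow> c \<in> Inl ` {c. (c, r) \<in> edges F1}"
              using s' by (cases c) (auto simp: root_children_def roots_graft[OF s(1,2)] s(4))
          qed
          moreover have "root_children F = {c. (c, r) \<in> edges F}"
            by (simp add: root_children_def root)
          moreover have "finite {c. (c, r) \<in> edges F}"
            by (rule finite_subset[OF _ F'(1)]) (use F'(2) in auto)
          ultimately show "card (root_children (graft s F1 F2)) < card (root_children F)"
            using psubset_card_mono[OF _ s(5)] by (simp add: card_image)
        qed
        then have "(\<Sum>s\<in>verts F1 - {r}. \<phi> (basis (graft s F1 F2)))
            = (\<Sum>s\<in>verts F1 - {r}. \<psi> (basis (graft s F1 F2)))"
          by (rule sum.cong[OF refl])
        moreover have "\<phi> R = (\<Sum>s\<in>verts F1 - {r}. \<phi> (basis (graft s F1 F2)))"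
          unfolding R_def using mem by (rule \<phi>.map_sum)
        moreover have "\<psi> R = (\<Sum>s\<in>verts F1 - {r}. \<psi> (basis (graft s F1 F2)))"
          unfolding R_def using mem by (rule \<psi>.map_sum)
        ultimately have "\<phi> R = \<psi> R" by simp
        moreover have "\<phi> (g_pre (basis F1) (basis F2)) = \<psi> (g_pre (basis F1) (basis F2))"
          using IH[OF s(1) d(1) c(1)] IH[OF s(2) d(2) c(2)] s(1,2) d
          by (simp add: \<phi>.map_pre \<psi>.map_pre basis_in_gPT)
        moreover have "(basis F :: _ \<Rightarrow>\<^sub>0 'k) \<in> gPT D" by (rule basis_in_gPT[OF F D])
        ultimately show ?thesis unfolding eq using R by (simp add: \<phi>.map_add \<psi>.map_add)
      qed
    qed
  qed
  show ?thesis using x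
    by (induction x rule: gPT_induct)
      (simp_all add: basis \<phi>.map_zero \<psi>.map_zero \<phi>.map_add \<psi>.map_add \<phi>.map_scale \<psi>.map_scale)
qed

section \<open>Existence of the morphism\<close>

context total_com_prelie
begin

definition eval_PT :: "('d \<Rightarrow> 'a) \<Rightarrow> ((nat, 'd) forest set \<Rightarrow>\<^sub>0 'k) \<Rightarrow> 'a" where
  "eval_PT a = lin_ext scale (\<lambda>t. tval a (rep t))"

lemma eval_PT_basis:
  assumes F: "partitioned_tree F"
  shows "eval_PT a (basis F) = tval a F"
proof -
  obtain f where f: "forest_iso f F (rep (isoclass F))"
    using rep_iso[of F] F by (auto simp: partitioned_tree_def)
  show ?thesis by (simp add: eval_PT_def basis_def lin_ext_single tval_iso[OF f F])
qed

lemma eval_PT_lin: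
  "eval_PT a 0 = 0" "eval_PT a (x + y) = eval_PT a x + eval_PT a y"
  "eval_PT a (g_scale c x) = scale c (eval_PT a x)" "eval_PT a (\<Sum>i\<in>I. z i) = (\<Sum>i\<in>I. eval_PT a (z i))"
  by (simp_all add: eval_PT_def lin_ext_add lin_ext_sum g_scale_def lin_ext_scale)

lemma eval_PT_pre:
  assumes "x \<in> gPT D" "y \<in> gPT D"
  shows "eval_PT a (g_pre x y) = pre (eval_PT a x) (eval_PT a y)"
  using assms
proof (induction x rule: gPT_induct)
  case F: (basis F)
  from F(3) show ?case
  proof (induction y rule: gPT_induct)
    case G: (basis G)
    show ?case using F(1) G(1)
      by (simp add: g_pre_basis eval_PT_lin eval_PT_basis partitioned_tree_graft pre_tval)
  qed (simp_all add: g_pre_lin eval_PT_lin pre_add_right pre_scale_right)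
qed (simp_all add: g_pre_lin eval_PT_lin pre_add_left pre_scale_left)

lemma eval_PT_sh:
  assumes "x \<in> gPT D" "y \<in> gPT D"
  shows "eval_PT a (g_sh x y) = sh (eval_PT a x) (eval_PT a y)"
  using assms
proof (induction x rule: gPT_induct)
  case F: (basis F)
  from F(3) show ?case
  proof (induction y rule: gPT_induct)
    case G: (basis G)
    show ?case using F(1) G(1)
      by (simp add: g_sh_basis eval_PT_basis partitioned_tree_merge tval_merge)
  next
    case zero
    show ?case using sh_commute[of _ 0] by (simp add: g_sh_lin eval_PT_lin)
  qed (simp_all add: g_sh_lin eval_PT_lin sh_add_right sh_scale_right)
qed (simp_all add: g_sh_lin eval_PT_lin sh_add_left sh_scale_left)

lemma eval_PT_dot: "eval_PT a (Poly_Mapping.single (dot d) 1) = a d"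
  using tval_single[of "dot_tree d" 0 a]
  by (simp add: single_dot eval_PT_basis partitioned_tree_dot) (simp add: dot_tree_def)

end

text \<open>\<open>P\<close> is a linear projection onto \<open>A\<close>, obtained as a left
  inverse of the inclusion. The modified products project both arguments first, so each identity for
  them is one between elements of \<open>A\<close>, on which \<open>P\<close> is the
  identity.\<close>

lemma (in com_prelie) total_extension:
  obtains P where "\<And>x. P x \<in> A" "\<And>x. x \<in> A \<Longrightarrow> P x = x" "\<And>x y. P (x + y) = P x + P y"
    "\<And>c x. P (scale c x) = scale c (P x)"
    "total_com_prelie scale (\<lambda>x y. pre (P x) (P y)) (\<lambda>x y. sh (P x) (P y))"
proof -
  interpret vp: vector_space_pair scale scale ..
  obtain P where P: "range P \<subseteq> A" "Vector_Spaces.linear scale scale P" "\<forall>x\<in>A. P (id x) = x"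
    using vp.linear_exists_left_inverse_on[OF linear_id subspace] by auto
  then interpret P: Vector_Spaces.linear scale scale P by simp
  have mem: "P x \<in> A" for x using P(1) by blast
  have id: "P x = x" if "x \<in> A" for x using P(3) that by simp
  have "total_com_prelie scale (\<lambda>x y. pre (P x) (P y)) (\<lambda>x y. sh (P x) (P y))"
    by standard
      (simp_all add: P.add P.scale mem id pre_closed sh_closed pre_add_left pre_add_right
        pre_scale_left pre_scale_right sh_add_left sh_add_right sh_scale_left sh_scale_right
        prelie sh_assoc leibniz sh_commute[OF mem mem])
  then show ?thesis using that mem id P.add P.scale by blast
qed

lemma com_prelie_hom_exists:
  fixes D :: "'d set" and A :: "'a::ab_group_add set" and scale :: "'k::field_char_0 \<Rightarrow> 'a \<Rightarrow> 'a"
  assumes "com_prelie scale A pre sh"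
  assumes "\<And>d. d \<in> D \<Longrightarrow> a d \<in> A"
  shows "\<exists>\<phi>. \<phi> \<in> extensional (gPT D) \<and>
    com_prelie_hom g_scale (gPT D) g_pre g_sh scale A pre sh \<phi> \<and>
    (\<forall>d\<in>D. \<phi> (Poly_Mapping.single (dot d) 1) = a d)"
proof -
  interpret A: com_prelie scale A pre sh by (rule assms)
  obtain P where P: "\<And>x. P x \<in> A" "\<And>x. x \<in> A \<Longrightarrow> P x = x" "\<And>x y. P (x + y) = P x + P y"
    "\<And>c x. P (scale c x) = scale c (P x)"
    and T: "total_com_prelie scale (\<lambda>x y. pre (P x) (P y)) (\<lambda>x y. sh (P x) (P y))"
    using A.total_extension by blast
  interpret T: total_com_prelie scale "\<lambda>x y. pre (P x) (P y)" "\<lambda>x y. sh (P x) (P y)" by (rule T)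
  \<comment> \<open>Applying \<open>P\<close> to the evaluation puts all values into
    \<open>A\<close> and turns the modified products back into the given ones;
    \<open>restrict\<close> fixes the default value outside \<open>gPT D\<close>, where a morphism
    is otherwise unconstrained.\<close>
  define \<phi> where "\<phi> = restrict (\<lambda>x. P (T.eval_PT a x)) (gPT D)"
  have "com_prelie_hom g_scale (gPT D) g_pre g_sh scale A pre sh \<phi>"
  proof (intro com_prelie_hom.intro com_prelie_hom_axioms.intro com_prelie_gPT assms(1))
    fix x y :: "(nat, 'd) forest set \<Rightarrow>\<^sub>0 'k" and c
    assume x: "x \<in> gPT D"
    show "\<phi> x \<in> A" using x by (simp add: \<phi>_def P)
    show "\<phi> (g_scale c x) = scale c (\<phi> x)"
      using x g.subspace_scale[OF subspace_gPT x] by (simp add: \<phi>_def P T.eval_PT_lin)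
    assume y: "y \<in> gPT D"
    show "\<phi> (x + y) = \<phi> x + \<phi> y"
      using x y g.subspace_add[OF subspace_gPT x y] by (simp add: \<phi>_def P T.eval_PT_lin)
    show "\<phi> (g_pre x y) = pre (\<phi> x) (\<phi> y)" "\<phi> (g_sh x y) = sh (\<phi> x) (\<phi> y)"
      using x y by (simp_all add: \<phi>_def P g_closed T.eval_PT_pre T.eval_PT_sh A.pre_closed A.sh_closed)
  qed
  moreover have "\<phi> (Poly_Mapping.single (dot d) 1) = a d" if "d \<in> D" for d
  proof -
    have "Poly_Mapping.single (dot d) (1 :: 'k) \<in> gPT D"
      unfolding single_dot
      by (rule basis_in_gPT[OF partitioned_tree_dot]) (use that in \<open>simp add: dot_tree_def\<close>)
    then show ?thesis using assms(2)[OF that] by (simp add: \<phi>_def T.eval_PT_dot P)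
  qed
  ultimately show ?thesis by (auto simp: \<phi>_def)
qed

theorem theorem20:
  fixes D :: "'d set"
    and scale :: "'k::field_char_0 \<Rightarrow> 'a::ab_group_add \<Rightarrow> 'a"
    and A :: "'a set"
    and pre sh :: "'a \<Rightarrow> 'a \<Rightarrow> 'a"
    and a :: "'d \<Rightarrow> 'a"
  assumes "com_prelie scale A pre sh"
    and "\<And>d. d \<in> D \<Longrightarrow> a d \<in> A"
  shows "\<exists>!\<phi>. \<phi> \<in> extensional (gPT D) \<and>
    com_prelie_hom g_scale (gPT D) g_pre g_sh scale A pre sh \<phi> \<and>
    (\<forall>d\<in>D. \<phi> (Poly_Mapping.single (dot d) 1) = a d)"
proof (rule ex_ex1I)
  show "\<exists>\<phi>. \<phi> \<in> extensional (gPT D) \<and>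
    com_prelie_hom g_scale (gPT D) g_pre g_sh scale A pre sh \<phi> \<and>
    (\<forall>d\<in>D. \<phi> (Poly_Mapping.single (dot d) 1) = a d)"
    by (rule com_prelie_hom_exists[OF assms])
next
  fix \<phi> \<psi>
  assume \<phi>: "\<phi> \<in> extensional (gPT D) \<and>
      com_prelie_hom g_scale (gPT D) g_pre g_sh scale A pre sh \<phi> \<and>
      (\<forall>d\<in>D. \<phi> (Poly_Mapping.single (dot d) 1) = a d)"
    and \<psi>: "\<psi> \<in> extensional (gPT D) \<and>
      com_prelie_hom g_scale (gPT D) g_pre g_sh scale A pre sh \<psi> \<and>
      (\<forall>d\<in>D. \<psi> (Poly_Mapping.single (dot d) 1) = a d)"
  show "\<phi> = \<psi>"
  proof (rule extensionalityI)
    show "\<phi> x = \<psi> x" if "x \<in> gPT D" for x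
      by (rule com_prelie_hom_unique[OF _ _ _ that]) (use \<phi> \<psi> in auto)
  qed (use \<phi> \<psi> in auto)
qed

end
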